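(* Let $n\ge2$, $\delta_n=(n-2,\dots,1,0,0)$, $P_{\delta_n}$ the convex hull of the $S_n$-orbit of $\delta_n$, and $\gamma_n$ the permutation representation of $S_n$ on $P_{\delta_n}\cap\mathbb{Z}^n$ by permuting coordinates. Let $c_n=\frac{(n-2)(n-1)}{2}$, let $\mathcal{C}_n$ be the set of $(x_1,\dots,x_n)\in\{0,\dots,n-1\}^n$ with $\sum_ix_i\equiv c_n\pmod n$, let $\widehat{\mathcal{C}}_n$ be the set of equivalence classes of $\mathcal{C}_n$ under $x\sim\mathrm{shift}^j(x)$ where $\mathrm{shift}(x_1,\dots,x_n)=(x_1+1,\dots,x_n+1)$ modulo $n$, and let $\widehat{\tau}_n$ be the induced permutation representation of $S_n$ on $\widehat{\mathcal{C}}_n$. Then $\gamma_n\cong\widehat{\tau}_n$, and the restriction of $\gamma_n$ to $S_{n-1}$ is isomorphic to $\mathrm{Park}_{n-1}$. Moreover, letting $\mathrm{Par}_{\le\delta_n}$ be the set of integer points $(\lambda_1\ge\cdots\ge\lambda_n)$ of $P_{\delta_n}$ and, for such $\lambda$, $\mathrm{mult}(\lambda)$ the partition formed by the multiplicities of the distinct values among $\lambda_1,\dots,\lambda_n$ (the value $0$ counted as a part), we have \[ \mathrm{Frob}(\gamma_n)=\mathrm{Frob}(\widehat{\tau}_n)=\sum_{\lambda\in\mathrm{Par}_{\le\delta_n}}h_{\mathrm{mult}(\lambda)}. \]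
   Context: A parking function of length $k$ is a sequence of positive integers whose nondecreasing rearrangement $b_1\le\dots\le b_k$ satisfies $b_i\le i$; $\mathrm{Park}_k$ is the permutation representation of $S_k$ on parking functions of length $k$ by permuting entries. $\mathrm{Frob}$ is the Frobenius characteristic and $h_\mu$ the complete homogeneous symmetric function. *)

theory Defs
  imports
    "HOL-Analysis.Analysis"
    "HOL-Analysis.Finite_Function_Topology"
    "HOL-Algebra.Sym_Groups"
    "HOL-Combinatorics.Orbits"
begin

section \<open>Complex linear representations\<close>

text \<open>
  \<open>'b \<Rightarrow>\<^sub>0 complex\<close> is the complex vector space with basis \<open>'b\<close>.
  A representation of a group acts on a subspace of such a space.
\<close>

definition cscale :: "complex \<Rightarrow> ('b \<Rightarrow>\<^sub>0 complex) \<Rightarrow> ('b \<Rightarrow>\<^sub>0 complex)" where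
  "cscale c f = Poly_Mapping.map ((*) c) f"

lemma lookup_cscale [simp]:
  "Poly_Mapping.lookup (cscale c f) x = c * Poly_Mapping.lookup f x"
  by (simp add: cscale_def Poly_Mapping.map.rep_eq when_def)

interpretation cfree: vector_space cscale
  by unfold_locales
    (auto intro!: poly_mapping_eqI simp: lookup_add algebra_simps)

record ('g, 'b) lin_rep =
  rep_space :: "('b \<Rightarrow>\<^sub>0 complex) set"
  rep_action :: "'g \<Rightarrow> ('b \<Rightarrow>\<^sub>0 complex) \<Rightarrow> ('b \<Rightarrow>\<^sub>0 complex)"

definition clinear_on ::
    "('b \<Rightarrow>\<^sub>0 complex) set \<Rightarrow> (('b \<Rightarrow>\<^sub>0 complex) \<Rightarrow> ('c \<Rightarrow>\<^sub>0 complex)) \<Rightarrow> bool" where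
  "clinear_on V T \<longleftrightarrow>
     (\<forall>v\<in>V. \<forall>w\<in>V. T (v + w) = T v + T w) \<and> (\<forall>c. \<forall>v\<in>V. T (cscale c v) = cscale c (T v))"

definition is_rep :: "('g, 'm) monoid_scheme \<Rightarrow> ('g, 'b) lin_rep \<Rightarrow> bool" where
  "is_rep G R \<longleftrightarrow>
     group G \<and> cfree.subspace (rep_space R) \<and>
     (\<forall>g\<in>carrier G. clinear_on (rep_space R) (rep_action R g) \<and>
        rep_action R g ` rep_space R \<subseteq> rep_space R) \<and>
     (\<forall>v\<in>rep_space R. rep_action R \<one>\<^bsub>G\<^esub> v = v) \<and>
     (\<forall>g\<in>carrier G. \<forall>h\<in>carrier G. \<forall>v\<in>rep_space R.
        rep_action R (g \<otimes>\<^bsub>G\<^esub> h) v = rep_action R g (rep_action R h v))"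

text \<open>
  Only the action of elements of \<open>carrier G\<close> matters, so the restriction of a representation
  to a subgroup is the same record considered over the smaller group.
\<close>

definition rep_iso ::
    "('g, 'm) monoid_scheme \<Rightarrow> ('g, 'b) lin_rep \<Rightarrow> ('g, 'c) lin_rep \<Rightarrow> bool" where
  "rep_iso G R S \<longleftrightarrow>
     is_rep G R \<and> is_rep G S \<and>
     (\<exists>T. clinear_on (rep_space R) T \<and> bij_betw T (rep_space R) (rep_space S) \<and>
          (\<forall>g\<in>carrier G. \<forall>v\<in>rep_space R. T (rep_action R g v) = rep_action S g (T v)))"

text \<open>The trace of an operator on a finite-dimensional space, computed in an arbitrary basis.\<close>

definition ctrace ::
    "('b \<Rightarrow>\<^sub>0 complex) set \<Rightarrow> (('b \<Rightarrow>\<^sub>0 complex) \<Rightarrow> ('b \<Rightarrow>\<^sub>0 complex)) \<Rightarrow> complex" where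
  "ctrace V T =
     (let B = (SOME B. cfree.independent B \<and> cfree.span B = V)
      in \<Sum>b\<in>B. cfree.representation B (T b) b)"

definition rep_character :: "('g, 'b) lin_rep \<Rightarrow> 'g \<Rightarrow> complex" where
  "rep_character R g = ctrace (rep_space R) (rep_action R g)"

text \<open>The permutation representation on \<open>\<complex>[X]\<close>: \<open>g\<close> sends the basis vector of \<open>x\<close>
  to that of \<open>act g x\<close>.\<close>

definition perm_rep :: "'b set \<Rightarrow> ('g \<Rightarrow> 'b \<Rightarrow> 'b) \<Rightarrow> ('g, 'b) lin_rep" where
  "perm_rep X act =
     \<lparr> rep_space = {f. Poly_Mapping.keys f \<subseteq> X},
       rep_action = (\<lambda>g f. \<Sum>x\<in>Poly_Mapping.keys f.
          Poly_Mapping.single (act g x) (Poly_Mapping.lookup f x)) \<rparr>"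


section \<open>Formal power series in countably many variables, symmetric functions\<close>

text \<open>
  Symmetric functions are elements of the ring of formal power series over \<open>\<complex>\<close> in
  \<open>x\<^sub>0, x\<^sub>1, \<dots>\<close>. A series is given by its coefficients; the monomial \<open>\<Prod>i. x\<^sub>i ^ (m i)\<close> is
  encoded by its exponent vector \<open>m :: nat \<Rightarrow>\<^sub>0 nat\<close>.
\<close>

typedef mseries = "UNIV :: ((nat \<Rightarrow>\<^sub>0 nat) \<Rightarrow> complex) set"
  morphisms mcoeff MSeries ..

setup_lifting type_definition_mseries

lemma mseries_eqI: "(\<And>m. mcoeff f m = mcoeff g m) \<Longrightarrow> f = g"
  by transfer auto

lemma finite_decomp: "finite {(a, b). a + b = (m :: nat \<Rightarrow>\<^sub>0 nat)}"
proof -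
  let ?S = "{(a, b). a + b = m}"
  let ?h = "\<lambda>(a, b :: nat \<Rightarrow>\<^sub>0 nat). restrict (Poly_Mapping.lookup a) (Poly_Mapping.keys m)"
  have le: "Poly_Mapping.lookup a i \<le> Poly_Mapping.lookup m i" if "a + b = m" for a b i
    using that by (auto simp: lookup_add)
  have "?h ` ?S \<subseteq> (\<Pi>\<^sub>E i\<in>Poly_Mapping.keys m. {..Poly_Mapping.lookup m i})"
    using le by fastforce
  then have fin: "finite (?h ` ?S)"
    by (rule finite_subset) (auto intro: finite_PiE)
  have "a = a'" if "a + b = m" "a' + b' = m"
    and eq: "restrict (Poly_Mapping.lookup a) (Poly_Mapping.keys m) =
      restrict (Poly_Mapping.lookup a') (Poly_Mapping.keys m)" for a b a' b'
  proof (rule poly_mapping_eqI)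
    fix i
    show "Poly_Mapping.lookup a i = Poly_Mapping.lookup a' i"
    proof (cases "i \<in> Poly_Mapping.keys m")
      case True
      then show ?thesis using fun_cong[OF eq, of i] by simp
    next
      case False
      then show ?thesis using le[OF that(1), of i] le[OF that(2), of i]
        by (simp add: in_keys_iff)
    qed
  qed
  then have "inj_on ?h ?S"
    by (auto intro!: inj_onI) (metis add_left_cancel)+
  with fin show ?thesis
    by (rule finite_imageD)
qed

instantiation mseries :: comm_ring_1
begin

lift_definition zero_mseries :: mseries is "\<lambda>_. 0" .

lift_definition one_mseries :: mseries is "\<lambda>m. if m = 0 then 1 else 0" .

lift_definition plus_mseries :: "mseries \<Rightarrow> mseries \<Rightarrow> mseries" is
  "\<lambda>f g m. f m + g m" .

lift_definition minus_mseries :: "mseries \<Rightarrow> mseries \<Rightarrow> mseries" is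
  "\<lambda>f g m. f m - g m" .

lift_definition uminus_mseries :: "mseries \<Rightarrow> mseries" is
  "\<lambda>f m. - f m" .

lift_definition times_mseries :: "mseries \<Rightarrow> mseries \<Rightarrow> mseries" is
  "\<lambda>f g m. \<Sum>(a, b)\<in>{(a, b). a + b = m}. f a * g b" .

instance
proof
  fix f g h :: mseries
  show "f * g * h = f * (g * h)"
  proof (transfer, rule ext)
    fix f g h :: "(nat \<Rightarrow>\<^sub>0 nat) \<Rightarrow> complex" and m
    let ?D = "\<lambda>m :: nat \<Rightarrow>\<^sub>0 nat. {(a, b). a + b = m}"
    have "(\<Sum>(a, b)\<in>?D m. (\<Sum>(a, b)\<in>?D a. f a * g b) * h b) =
        (\<Sum>(p, q)\<in>Sigma (?D m) (\<lambda>p. ?D (fst p)). f (fst q) * g (snd q) * h (snd p))"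
      by (subst sum.Sigma[symmetric])
        (simp_all add: finite_decomp sum_distrib_right case_prod_beta mult.assoc)
    also have "\<dots> =
        (\<Sum>(p, q)\<in>Sigma (?D m) (\<lambda>p. ?D (snd p)). f (fst p) * (g (fst q) * h (snd q)))"
      by (rule sum.reindex_bij_witness
          [where i = "\<lambda>((a, s), (b, c)). ((a + b, c), (a, b))"
             and j = "\<lambda>((s, c), (a, b)). ((a, b + c), (b, c))"])
        (auto simp: add.assoc)
    also have "\<dots> = (\<Sum>(a, b)\<in>?D m. f a * (\<Sum>(a, b)\<in>?D b. g a * h b))"
      by (subst sum.Sigma[symmetric])
        (simp_all add: finite_decomp sum_distrib_left case_prod_beta mult.assoc)
    finally show "(\<Sum>(a, b)\<in>?D m. (\<Sum>(a, b)\<in>?D a. f a * g b) * h b) =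
        (\<Sum>(a, b)\<in>?D m. f a * (\<Sum>(a, b)\<in>?D b. g a * h b))" .
  qed
  show "f * g = g * f"
    by (transfer, rule ext, rule sum.reindex_bij_witness
        [where i = "\<lambda>(a, b). (b, a)" and j = "\<lambda>(a, b). (b, a)"])
      (auto simp: add.commute mult.commute)
  show "1 * f = f"
  proof (transfer, rule ext)
    fix f :: "(nat \<Rightarrow>\<^sub>0 nat) \<Rightarrow> complex" and m
    have "(\<Sum>(a, b)\<in>{(a, b). a + b = m}. (if a = 0 then 1 else 0) * f b) =
        (\<Sum>(a, b)\<in>{(0 :: nat \<Rightarrow>\<^sub>0 nat, m)}. (if a = 0 then 1 else 0) * f b)"
      by (rule sum.mono_neutral_right) (auto simp: finite_decomp split: if_splits)
    then show "(\<Sum>(a, b)\<in>{(a, b). a + b = m}. (if a = 0 then 1 else 0) * f b) = f m"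
      by simp
  qed
  show "(f + g) * h = f * h + g * h"
    by (transfer, rule ext) (simp add: case_prod_beta sum.distrib distrib_right)
  show "(0 :: mseries) \<noteq> 1"
    by transfer (metis zero_neq_one)
qed (transfer; simp add: fun_eq_iff add.assoc add.commute)+

end

lift_definition mconst :: "complex \<Rightarrow> mseries" is "\<lambda>c m. if m = 0 then c else 0" .

definition mdegree :: "(nat \<Rightarrow>\<^sub>0 nat) \<Rightarrow> nat" where
  "mdegree m = (\<Sum>i\<in>Poly_Mapping.keys m. Poly_Mapping.lookup m i)"

text \<open>\<open>h\<^sub>k\<close> is the sum of all monomials of degree \<open>k\<close>; \<open>p\<^sub>k\<close> (for \<open>k \<ge> 1\<close>) is \<open>\<Sum>i. x\<^sub>i ^ k\<close>.\<close>

lift_definition complete_homogeneous :: "nat \<Rightarrow> mseries" is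
  "\<lambda>k m. if mdegree m = k then 1 else 0" .

lift_definition power_sum :: "nat \<Rightarrow> mseries" is
  "\<lambda>k m. if \<exists>i. m = Poly_Mapping.single i k then 1 else 0" .

text \<open>Partitions are multisets of positive integers.\<close>

definition h_part :: "nat multiset \<Rightarrow> mseries" where
  "h_part \<mu> = (\<Prod>k\<in>#\<mu>. complete_homogeneous k)"

definition p_part :: "nat multiset \<Rightarrow> mseries" where
  "p_part \<mu> = (\<Prod>k\<in>#\<mu>. power_sum k)"

text \<open>The cycle type of \<open>\<sigma> \<in> S\<^sub>n\<close>; fixed points contribute parts equal to 1.\<close>

definition cycle_type :: "nat \<Rightarrow> (nat \<Rightarrow> nat) \<Rightarrow> nat multiset" where
  "cycle_type n \<sigma> = image_mset card (mset_set (Orbits.orbit \<sigma> ` {1..n}))"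

definition Frob :: "nat \<Rightarrow> (nat \<Rightarrow> nat, 'b) lin_rep \<Rightarrow> mseries" where
  "Frob n R =
     mconst (1 / fact n) *
     (\<Sum>\<sigma>\<in>carrier (sym_group n). mconst (rep_character R \<sigma>) * p_part (cycle_type n \<sigma>))"


section \<open>The representations\<close>

text \<open>
  An \<open>n\<close>-tuple \<open>(x\<^sub>1, \<dots>, x\<^sub>n)\<close> is a function in \<open>{1..n} \<rightarrow>\<^sub>E _\<close>. Permutations act on the left
  by \<open>(\<sigma> \<cdot> x)\<^sub>i = x\<^bsub>\<sigma>\<inverse>(i)\<^esub>\<close>. Elements of \<open>S\<^sub>n\<close> fix every index outside \<open>{1..n}\<close>, so
  extensionality is preserved.
\<close>

definition permute :: "(nat \<Rightarrow> nat) \<Rightarrow> (nat \<Rightarrow> 'a) \<Rightarrow> (nat \<Rightarrow> 'a)" where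
  "permute \<sigma> x = x \<circ> inv' \<sigma>"

text \<open>\<open>\<real>\<^sup>n\<close> is the space of vectors in \<open>nat \<Rightarrow>\<^sub>0 real\<close> supported in \<open>{1..n}\<close>;
  an integer tuple is viewed as the vector \<open>\<Sum>i. x\<^sub>i e\<^sub>i\<close>.\<close>

definition real_point :: "nat \<Rightarrow> (nat \<Rightarrow> int) \<Rightarrow> (nat \<Rightarrow>\<^sub>0 real)" where
  "real_point n x = (\<Sum>i\<in>{1..n}. Poly_Mapping.single i (real_of_int (x i)))"

text \<open>\<open>(n-2, \<dots>, 1, 0, 0)\<close>: the subtraction is truncated, which matters only for \<open>i = n\<close>.\<close>

definition delta :: "nat \<Rightarrow> (nat \<Rightarrow> int)" where
  "delta n = (\<lambda>i\<in>{1..n}. int (n - 1 - i))"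

definition P_delta :: "nat \<Rightarrow> (nat \<Rightarrow>\<^sub>0 real) set" where
  "P_delta n = convex hull {real_point n (permute \<sigma> (delta n)) | \<sigma>. \<sigma> \<in> carrier (sym_group n)}"

definition lattice_points :: "nat \<Rightarrow> (nat \<Rightarrow> int) set" where
  "lattice_points n = {x \<in> {1..n} \<rightarrow>\<^sub>E UNIV. real_point n x \<in> P_delta n}"

definition gamma_rep :: "nat \<Rightarrow> (nat \<Rightarrow> nat, nat \<Rightarrow> int) lin_rep" where
  "gamma_rep n = perm_rep (lattice_points n) permute"

definition c_num :: "nat \<Rightarrow> nat" where
  "c_num n = (n - 2) * (n - 1) div 2"

definition C_set :: "nat \<Rightarrow> (nat \<Rightarrow> nat) set" where
  "C_set n = {x \<in> {1..n} \<rightarrow>\<^sub>E {0..n-1}. (\<Sum>i\<in>{1..n}. x i) mod n = c_num n mod n}"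

definition shift :: "nat \<Rightarrow> (nat \<Rightarrow> nat) \<Rightarrow> (nat \<Rightarrow> nat)" where
  "shift n x = (\<lambda>i\<in>{1..n}. (x i + 1) mod n)"

definition shift_rel :: "nat \<Rightarrow> ((nat \<Rightarrow> nat) \<times> (nat \<Rightarrow> nat)) set" where
  "shift_rel n = {(x, y) \<in> C_set n \<times> C_set n. \<exists>j. y = (shift n ^^ j) x}"

definition C_hat :: "nat \<Rightarrow> (nat \<Rightarrow> nat) set set" where
  "C_hat n = C_set n // shift_rel n"

definition tau_hat_rep :: "nat \<Rightarrow> (nat \<Rightarrow> nat, (nat \<Rightarrow> nat) set) lin_rep" where
  "tau_hat_rep n = perm_rep (C_hat n) (\<lambda>\<sigma> c. permute \<sigma> ` c)"

text \<open>The list \<open>sort [x\<^sub>1, \<dots>, x\<^sub>k]\<close> is indexed from 0, hence the entry \<open>i - 1\<close>.\<close>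

definition parking_functions :: "nat \<Rightarrow> (nat \<Rightarrow> nat) set" where
  "parking_functions k =
     {x \<in> {1..k} \<rightarrow>\<^sub>E {1..}. \<forall>i\<in>{1..k}. sort (map x [1..<Suc k]) ! (i - 1) \<le> i}"

definition Park :: "nat \<Rightarrow> (nat \<Rightarrow> nat, nat \<Rightarrow> nat) lin_rep" where
  "Park k = perm_rep (parking_functions k) permute"

definition Par_le_delta :: "nat \<Rightarrow> (nat \<Rightarrow> int) set" where
  "Par_le_delta n = {x \<in> lattice_points n. antimono_on {1..n} x}"

definition mult_part :: "nat \<Rightarrow> (nat \<Rightarrow> int) \<Rightarrow> nat multiset" where
  "mult_part n x = image_mset (\<lambda>v. card {i \<in> {1..n}. x i = v}) (mset_set (x ` {1..n}))"

end

theory Submission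
  imports Defs "HOL-Algebra.Group_Action" "HOL-Number_Theory.Cong"
begin

text \<open>
  Both \<open>P\<^sub>\<delta> \<inter> \<int>\<^sup>n\<close> and the parking functions of length \<open>n - 1\<close> are systems of representatives for
  the shift classes, compatibly with the symmetric groups, so the isomorphisms come from
  equivariant bijections. By Rado's theorem the lattice points are the integer points of total
  \<open>(n-1)(n-2)/2\<close> whose sum over every \<open>k\<close>-subset is at least \<open>(k-1)(k-2)/2\<close>, that is, the break
  divisors of the complete graph. Two points of that total lie in the same shift class if and only if
  they differ by a graph Laplacian; a representative of least norm is a break divisor, and two
  equivalent break divisors coincide. For parking functions the analogous statement is Pollak's
  circular argument, with existence again by minimality.

  For the Frobenius characteristic, the coefficient of a monomial in \<open>p\<^bsub>cyc \<sigma>\<^esub>\<close> counts the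
  \<open>\<sigma>\<close>-invariant colourings \<open>w\<close> of \<open>{1..n}\<close> with the given content, so by Burnside's lemma the
  coefficient of the characteristic of a permutation representation on tuples counts the orbits of
  pairs \<open>(x, w)\<close>. Such an orbit is determined by the contents of \<open>w\<close> on the fibres of \<open>x\<close>; those
  with a given sorted \<open>x\<close> are counted by the coefficient of \<open>h\<^bsub>mult x\<^esub>\<close>.
\<close>

subsection \<open>Permutation representations\<close>

text \<open>The linear extension of \<open>h\<close> to the free spaces. With
  \<open>h = act g\<close> it is the action in \<open>perm_rep\<close>; with an equivariant map of
  bases it is an intertwiner.\<close>

definition push :: "('b \<Rightarrow> 'c) \<Rightarrow> ('b \<Rightarrow>\<^sub>0 complex) \<Rightarrow> ('c \<Rightarrow>\<^sub>0 complex)" where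
  "push h f = (\<Sum>x\<in>Poly_Mapping.keys f. Poly_Mapping.single (h x) (Poly_Mapping.lookup f x))"

text \<open>Terms outside the support vanish. Passing to a common index set gives additivity, since
  the support of a sum depends on cancellation.\<close>

lemma push_superset:
  assumes "finite S" "Poly_Mapping.keys f \<subseteq> S"
  shows "push h f = (\<Sum>x\<in>S. Poly_Mapping.single (h x) (Poly_Mapping.lookup f x))"
  unfolding push_def using assms
  by (intro sum.mono_neutral_left) (auto simp: in_keys_iff)

lemma push_single [simp]: "push h (Poly_Mapping.single x c) = Poly_Mapping.single (h x) c"
  by (subst push_superset[of "{x}"]) auto

lemma push_add: "push h (f + g) = push h f + push h g"
proof -
  let ?S = "Poly_Mapping.keys f \<union> Poly_Mapping.keys g"
  have "push h (f + g) = (\<Sum>x\<in>?S. Poly_Mapping.single (h x) (Poly_Mapping.lookup (f + g) x))"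
    by (rule push_superset) (use Poly_Mapping.keys_add[of f g] in auto)
  also have "\<dots> = push h f + push h g"
    by (subst (1 2) push_superset[of ?S]) (auto simp: lookup_add single_add sum.distrib)
  finally show ?thesis .
qed

lemma push_zero [simp]: "push h 0 = 0"
  by (simp add: push_def)

lemma push_sum: "push h (\<Sum>i\<in>I. f i) = (\<Sum>i\<in>I. push h (f i))"
  by (induction I rule: infinite_finite_induct) (auto simp: push_add)

lemma cscale_single: "cscale c (Poly_Mapping.single x d) = Poly_Mapping.single x (c * d)"
  by (intro poly_mapping_eqI) (auto simp: lookup_single when_def)

lemma keys_cscale: "Poly_Mapping.keys (cscale c f) \<subseteq> Poly_Mapping.keys f"
  by (auto simp: in_keys_iff)

lemma push_cscale: "push h (cscale c f) = cscale c (push h f)"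
proof -
  have "push h (cscale c f) =
      (\<Sum>x\<in>Poly_Mapping.keys f. Poly_Mapping.single (h x) (Poly_Mapping.lookup (cscale c f) x))"
    by (rule push_superset) (use keys_cscale[of c f] in auto)
  also have "\<dots> = cscale c (push h f)"
    by (simp add: push_def cfree.scale_sum_right cscale_single)
  finally show ?thesis .
qed

lemma push_cong: "(\<And>x. x \<in> Poly_Mapping.keys f \<Longrightarrow> h x = k x) \<Longrightarrow> push h f = push k f"
  by (simp add: push_def)

lemma push_id: "push (\<lambda>x. x) f = f"
  by (intro poly_mapping_eqI)
    (auto simp: push_def lookup_sum lookup_single when_def in_keys_iff)

lemma push_push: "push h (push k f) = push (\<lambda>x. h (k x)) f"
  by (simp add: push_def[of k] push_sum) (simp add: push_def)

lemma keys_push: "Poly_Mapping.keys (push h f) \<subseteq> h ` Poly_Mapping.keys f"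
  unfolding push_def by (rule order_trans[OF Poly_Mapping.keys_sum]) (auto split: if_splits)

lemma keys_push_subset:
  assumes "Poly_Mapping.keys f \<subseteq> X" "\<And>x. x \<in> X \<Longrightarrow> h x \<in> Y"
  shows "Poly_Mapping.keys (push h f) \<subseteq> Y"
  using assms keys_push[of h f] by blast

lemma perm_rep_simps [simp]:
  "rep_space (perm_rep X act) = {f. Poly_Mapping.keys f \<subseteq> X}"
  "rep_action (perm_rep X act) g = push (act g)"
  by (auto simp: perm_rep_def push_def fun_eq_iff)

text \<open>The laws are relative to \<open>carrier G\<close> and \<open>X\<close>, so that globally
  defined maps such as \<open>permute\<close> qualify; \<open>group_action\<close> asks for
  extensional maps.\<close>

definition action_on :: "('g, 'm) monoid_scheme \<Rightarrow> 'b set \<Rightarrow> ('g \<Rightarrow> 'b \<Rightarrow> 'b) \<Rightarrow> bool" where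
  "action_on G X act \<longleftrightarrow> group G \<and> (\<forall>g\<in>carrier G. \<forall>x\<in>X. act g x \<in> X) \<and>
     (\<forall>x\<in>X. act \<one>\<^bsub>G\<^esub> x = x) \<and>
     (\<forall>g\<in>carrier G. \<forall>h\<in>carrier G. \<forall>x\<in>X. act (g \<otimes>\<^bsub>G\<^esub> h) x = act g (act h x))"

lemma clinear_on_push: "clinear_on V (push h)"
  by (auto simp: clinear_on_def push_add push_cscale)

lemma subspace_keys_subset: "cfree.subspace {f. Poly_Mapping.keys f \<subseteq> X}"
  unfolding cfree.subspace_def
proof (intro conjI ballI allI)
  show "f + g \<in> {f. Poly_Mapping.keys f \<subseteq> X}"
    if "f \<in> {f. Poly_Mapping.keys f \<subseteq> X}" "g \<in> {f. Poly_Mapping.keys f \<subseteq> X}" for f g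
    using that Poly_Mapping.keys_add[of f g] by auto
  show "cscale c f \<in> {f. Poly_Mapping.keys f \<subseteq> X}"
    if "f \<in> {f. Poly_Mapping.keys f \<subseteq> X}" for c f
    using that keys_cscale[of c f] by auto
qed auto

lemma is_rep_perm_rep:
  assumes "action_on G X act"
  shows "is_rep G (perm_rep X act)"
  unfolding is_rep_def perm_rep_simps
proof (intro conjI ballI)
  show "group G"
    using assms by (simp add: action_on_def)
  show "cfree.subspace {f. Poly_Mapping.keys f \<subseteq> X}"
    by (rule subspace_keys_subset)
  show "push (act g) ` {f. Poly_Mapping.keys f \<subseteq> X} \<subseteq> {f. Poly_Mapping.keys f \<subseteq> X}"
    if "g \<in> carrier G" for g
    using that assms keys_push_subset[of _ X "act g" X] by (auto simp: action_on_def)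
  show "push (act \<one>\<^bsub>G\<^esub>) v = v" if "v \<in> {f. Poly_Mapping.keys f \<subseteq> X}" for v
    using push_cong[of v "act \<one>\<^bsub>G\<^esub>" "\<lambda>x. x"] that assms by (auto simp: push_id action_on_def)
  show "push (act (g \<otimes>\<^bsub>G\<^esub> h)) v = push (act g) (push (act h) v)"
    if "g \<in> carrier G" "h \<in> carrier G" "v \<in> {f. Poly_Mapping.keys f \<subseteq> X}" for g h v
    unfolding push_push using that assms by (intro push_cong) (auto simp: action_on_def)
qed (rule clinear_on_push)

text \<open>The linear extension of an equivariant bijection is an intertwiner, inverted by the
  linear extension of the inverse bijection.\<close>

lemma rep_iso_perm_rep:
  assumes "action_on G X act" "action_on G Y act'"
    and bij: "bij_betw \<phi> X Y"
    and equiv: "\<And>g x. g \<in> carrier G \<Longrightarrow> x \<in> X \<Longrightarrow> \<phi> (act g x) = act' g (\<phi> x)"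
  shows "rep_iso G (perm_rep X act) (perm_rep Y act')"
  unfolding rep_iso_def
proof (intro conjI exI[of _ "push \<phi>"] is_rep_perm_rep assms clinear_on_push ballI)
  let ?\<psi> = "the_inv_into X \<phi>"
  have inv: "?\<psi> (\<phi> x) = x" if "x \<in> X" for x
    using bij that by (simp add: bij_betw_def the_inv_into_f_f)
  have inv': "\<phi> (?\<psi> y) = y" "?\<psi> y \<in> X" if "y \<in> Y" for y
    using bij that by (auto simp: bij_betw_def f_the_inv_into_f intro: the_inv_into_into)
  show "bij_betw (push \<phi>) (rep_space (perm_rep X act)) (rep_space (perm_rep Y act'))"
  proof (rule bij_betw_byWitness[where f' = "push ?\<psi>"], goal_cases)
    case 1
    have "push ?\<psi> (push \<phi> f) = f" if "Poly_Mapping.keys f \<subseteq> X" for f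
      unfolding push_push using push_cong[of f _ "\<lambda>x. x"] that inv
      by (metis push_id subset_iff)
    then show ?case by simp
  next
    case 2
    have "push \<phi> (push ?\<psi> f) = f" if "Poly_Mapping.keys f \<subseteq> Y" for f
      unfolding push_push using push_cong[of f _ "\<lambda>x. x"] that inv'
      by (metis push_id subset_iff)
    then show ?case by simp
  next
    case 3
    have "\<phi> x \<in> Y" if "x \<in> X" for x using bij that by (auto simp: bij_betw_def)
    then show ?case using keys_push_subset[of _ X \<phi> Y] by auto
  next
    case 4
    then show ?case using keys_push_subset[of _ Y ?\<psi> X] inv' by auto
  qed
  show "push \<phi> (rep_action (perm_rep X act) g v) = rep_action (perm_rep Y act') g (push \<phi> v)"
    if "g \<in> carrier G" "v \<in> rep_space (perm_rep X act)" for g v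
    using that by (auto simp: push_push intro!: push_cong equiv)
qed

section \<open>The standard basis, traces and characters\<close>

lemma poly_mapping_eq_sum_cscale:
  assumes "finite X" "Poly_Mapping.keys f \<subseteq> X"
  shows "f = (\<Sum>x\<in>X. cscale (Poly_Mapping.lookup f x) (Poly_Mapping.single x 1))"
  using push_superset[OF assms, of "\<lambda>x. x"] by (simp add: push_id cscale_single)

lemma span_singles:
  assumes "finite X"
  shows "cfree.span ((\<lambda>x. Poly_Mapping.single x 1) ` X) = {f. Poly_Mapping.keys f \<subseteq> X}"
proof (intro equalityI subsetI)
  fix f :: "'a \<Rightarrow>\<^sub>0 complex"
  assume "f \<in> {f. Poly_Mapping.keys f \<subseteq> X}"
  then have "f = (\<Sum>x\<in>X. cscale (Poly_Mapping.lookup f x) (Poly_Mapping.single x 1))"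
    using poly_mapping_eq_sum_cscale[OF assms] by auto
  also have "\<dots> \<in> cfree.span ((\<lambda>x. Poly_Mapping.single x 1) ` X)"
    by (intro cfree.span_sum cfree.span_scale cfree.span_base) auto
  finally show "f \<in> cfree.span ((\<lambda>x. Poly_Mapping.single x 1) ` X)" .
next
  fix f :: "'a \<Rightarrow>\<^sub>0 complex"
  assume "f \<in> cfree.span ((\<lambda>x. Poly_Mapping.single x 1) ` X)"
  moreover have "(\<lambda>x. Poly_Mapping.single x (1 :: complex)) ` X \<subseteq> {f. Poly_Mapping.keys f \<subseteq> X}"
    by auto
  ultimately show "f \<in> {f. Poly_Mapping.keys f \<subseteq> X}"
    using cfree.span_minimal[OF _ subspace_keys_subset] by blast
qed

lemma independent_singles:
  assumes "finite X"
  shows "cfree.independent ((\<lambda>x. Poly_Mapping.single x (1 :: complex)) ` X)"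
proof (subst cfree.independent_explicit_finite_subsets, intro allI impI ballI)
  fix A u v
  assume A: "A \<subseteq> (\<lambda>x. Poly_Mapping.single x (1 :: complex)) ` X" "finite A"
    and sum: "(\<Sum>v\<in>A. cscale (u v) v) = 0" and v: "v \<in> A"
  from A v obtain x where x: "v = Poly_Mapping.single x 1" by auto
  have "0 = Poly_Mapping.lookup (\<Sum>v\<in>A. cscale (u v) v) x"
    using sum by simp
  also have "\<dots> = (\<Sum>w\<in>A. u w * Poly_Mapping.lookup w x)"
    by (simp add: lookup_sum)
  also have "\<dots> = (\<Sum>w\<in>A. if w = v then u v else 0)"
  proof (intro sum.cong refl)
    fix w assume "w \<in> A"
    then obtain y where "w = Poly_Mapping.single y 1" using A(1) by auto
    then show "u w * Poly_Mapping.lookup w x = (if w = v then u v else 0)"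
      by (cases "y = x") (auto simp: x lookup_single when_def dest: fun_cong[OF arg_cong[of _ _ Poly_Mapping.lookup], of _ _ x])
  qed
  finally show "u v = 0"
    using A v by simp
qed

text \<open>The basis chosen by \<^const>\<open>ctrace\<close> is arbitrary, so this is the invariance of the trace
  under a change of basis: expand each vector of one basis in the other.\<close>

lemma ctrace_eq_diagonal:
  assumes X: "finite X" and V: "V = {f. Poly_Mapping.keys f \<subseteq> X}"
    and lin: "clinear_on V T" and clo: "T ` V \<subseteq> V"
  shows "ctrace V T = (\<Sum>x\<in>X. Poly_Mapping.lookup (T (Poly_Mapping.single x 1)) x)"
proof -
  let ?e = "\<lambda>x. Poly_Mapping.single x (1 :: complex)"
  let ?E = "?e ` X"
  define B where "B = (SOME B. cfree.independent B \<and> cfree.span B = V)"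
  have "cfree.independent B \<and> cfree.span B = V"
    unfolding B_def
    by (rule someI[of _ ?E]) (auto simp: independent_singles[OF X] span_singles[OF X] V)
  then have ind: "cfree.independent B" and span: "cfree.span B = V" by auto
  \<comment> \<open>\<open>B\<close> is independent and lies in the span of the finite set
    \<open>?E\<close>, so the exchange lemma bounds its size.\<close>
  have finB: "finite B"
    using cfree.independent_span_bound[of ?E B] X ind span cfree.span_superset[of B]
    by (simp add: span_singles V)
  let ?r = "cfree.representation B"
  have eV: "?e x \<in> V" if "x \<in> X" for x
    using that V by auto
  have V0: "0 \<in> V" by (simp add: V)
  have subV: "cfree.subspace V"
    using span cfree.subspace_span by metis
  have T0: "T 0 = 0"
    using lin V0 by (auto simp: clinear_on_def) (metis add_cancel_left_left)
  have Tsum: "T (\<Sum>i\<in>I. cscale (c i) (v i)) = (\<Sum>i\<in>I. cscale (c i) (T (v i)))"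
    if "finite I" "\<And>i. i \<in> I \<Longrightarrow> v i \<in> V" for I :: "'a set" and c v
    using that
  proof (induction I rule: finite_induct)
    case empty then show ?case by (simp add: T0)
  next
    case (insert i I)
    have "(\<Sum>i\<in>I. cscale (c i) (v i)) \<in> V" "cscale (c i) (v i) \<in> V"
      using insert subV by (auto intro!: cfree.subspace_sum cfree.subspace_scale)
    then show ?case
      using insert lin by (auto simp: clinear_on_def)
  qed
  have expand: "(\<Sum>x\<in>X. cscale (Poly_Mapping.lookup f x) (?e x)) = f" if "f \<in> V" for f
    using that poly_mapping_eq_sum_cscale[OF X, of f] V by auto
  have rsum: "?r f b = (\<Sum>x\<in>X. Poly_Mapping.lookup f x * ?r (?e x) b)" if "f \<in> V" for f b
  proof -
    have "?r f b = ?r (\<Sum>x\<in>X. cscale (Poly_Mapping.lookup f x) (?e x)) b"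
      using expand[OF that] by simp
    also have "\<dots> = (\<Sum>x\<in>X. ?r (cscale (Poly_Mapping.lookup f x) (?e x)) b)"
      by (subst cfree.representation_sum[OF ind])
        (use eV span in \<open>auto intro: cfree.span_scale\<close>)
    also have "\<dots> = (\<Sum>x\<in>X. Poly_Mapping.lookup f x * ?r (?e x) b)"
      by (intro sum.cong refl) (use eV span in \<open>simp add: cfree.representation_scale[OF ind]\<close>)
    finally show ?thesis .
  qed
  have Tr: "?r (T b) b = (\<Sum>x\<in>X. Poly_Mapping.lookup b x *
      (\<Sum>y\<in>X. Poly_Mapping.lookup (T (?e x)) y * ?r (?e y) b))" if "b \<in> B" for b
  proof -
    have bV: "b \<in> V" using that span cfree.span_base by auto
    have TeV: "T (?e x) \<in> V" if "x \<in> X" for x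
      using clo eV that by auto
    have "T b = (\<Sum>x\<in>X. cscale (Poly_Mapping.lookup b x) (T (?e x)))"
      using Tsum[OF X, of ?e "Poly_Mapping.lookup b"] eV expand[OF bV] by auto
    then have "?r (T b) b = ?r (\<Sum>x\<in>X. cscale (Poly_Mapping.lookup b x) (T (?e x))) b"
      by simp
    also have "\<dots> = (\<Sum>x\<in>X. ?r (cscale (Poly_Mapping.lookup b x) (T (?e x))) b)"
      by (subst cfree.representation_sum[OF ind])
        (use TeV span in \<open>auto intro: cfree.span_scale\<close>)
    also have "\<dots> = (\<Sum>x\<in>X. Poly_Mapping.lookup b x * ?r (T (?e x)) b)"
      by (intro sum.cong refl) (use TeV span in \<open>simp add: cfree.representation_scale[OF ind]\<close>)
    also have "\<dots> = (\<Sum>x\<in>X. Poly_Mapping.lookup b x *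
      (\<Sum>y\<in>X. Poly_Mapping.lookup (T (?e x)) y * ?r (?e y) b))"
      by (intro sum.cong refl) (simp add: rsum[OF TeV])
    finally show ?thesis .
  qed
  \<comment> \<open>The two change-of-basis matrices compose to the identity. Once the sum over
    \<open>B\<close> is innermost, this collapses the trace to the diagonal in the standard
    basis.\<close>
  have dual: "(\<Sum>b\<in>B. ?r (?e y) b * Poly_Mapping.lookup b x) = (if x = y then 1 else 0)"
    if "y \<in> X" for x y
  proof -
    have "(\<Sum>b\<in>B. ?r (?e y) b * Poly_Mapping.lookup b x) =
        Poly_Mapping.lookup (\<Sum>b\<in>B. cscale (?r (?e y) b) b) x"
      by (simp add: lookup_sum)
    also have "(\<Sum>b\<in>B. cscale (?r (?e y) b) b) = ?e y"
      by (rule cfree.sum_representation_eq[OF ind]) (use span eV that finB in auto)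
    finally show ?thesis by (auto simp: lookup_single when_def)
  qed
  have "ctrace V T = (\<Sum>b\<in>B. ?r (T b) b)"
    by (simp add: ctrace_def B_def Let_def)
  also have "\<dots> = (\<Sum>b\<in>B. \<Sum>x\<in>X. \<Sum>y\<in>X.
      Poly_Mapping.lookup (T (?e x)) y * (?r (?e y) b * Poly_Mapping.lookup b x))"
    by (intro sum.cong refl) (simp add: Tr sum_distrib_left mult_ac)
  also have "\<dots> = (\<Sum>x\<in>X. \<Sum>y\<in>X. \<Sum>b\<in>B.
      Poly_Mapping.lookup (T (?e x)) y * (?r (?e y) b * Poly_Mapping.lookup b x))"
    by (subst sum.swap, intro sum.cong refl) (rule sum.swap)
  also have "\<dots> = (\<Sum>x\<in>X. \<Sum>y\<in>X. Poly_Mapping.lookup (T (?e x)) y * (if x = y then 1 else 0))"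
    by (intro sum.cong refl) (simp add: sum_distrib_left[symmetric] dual)
  also have "\<dots> = (\<Sum>x\<in>X. Poly_Mapping.lookup (T (?e x)) x)"
    using X by (simp add: if_distrib[of "(*) _"] cong: if_cong)
  finally show ?thesis .
qed

text \<open>The diagonal entry at \<open>x\<close> is 1 if \<open>x\<close> is fixed by
  \<open>g\<close> and 0 otherwise.\<close>

lemma rep_character_perm_rep:
  assumes "finite X" "\<And>x. x \<in> X \<Longrightarrow> act g x \<in> X"
  shows "rep_character (perm_rep X act) g = of_nat (card {x \<in> X. act g x = x})"
proof -
  have "rep_character (perm_rep X act) g =
      (\<Sum>x\<in>X. Poly_Mapping.lookup (push (act g) (Poly_Mapping.single x 1)) x)"
    unfolding rep_character_def perm_rep_simps
    by (rule ctrace_eq_diagonal[OF assms(1) refl clinear_on_push])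
      (use assms(2) keys_push_subset[of _ X "act g" X] in auto)
  also have "\<dots> = (\<Sum>x\<in>X. if act g x = x then 1 else 0)"
    by (intro sum.cong refl) (auto simp: lookup_single when_def)
  also have "\<dots> = of_nat (card {x \<in> X. act g x = x})"
    using assms(1) by (simp add: sum.If_cases Int_def)
  finally show ?thesis .
qed

subsection \<open>Coefficients of products of multiplicity-free series\<close>

lemma mcoeff_times: "mcoeff (f * g) m = (\<Sum>(a, b)\<in>{(a, b). a + b = m}. mcoeff f a * mcoeff g b)"
  by (simp add: times_mseries.rep_eq)

lemma mcoeff_mconst_times: "mcoeff (mconst c * f) m = c * mcoeff f m"
proof -
  have "mcoeff (mconst c * f) m =
      (\<Sum>(a, b)\<in>{(0 :: nat \<Rightarrow>\<^sub>0 nat, m)}. mcoeff (mconst c) a * mcoeff f b)"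
    unfolding mcoeff_times
    by (rule sum.mono_neutral_right) (auto simp: finite_decomp mconst.rep_eq split: if_splits)
  then show ?thesis by (simp add: mconst.rep_eq)
qed

lemma mcoeff_sum: "mcoeff (\<Sum>i\<in>I. f i) m = (\<Sum>i\<in>I. mcoeff (f i) m)"
  by (induction I rule: infinite_finite_induct) (auto simp: zero_mseries.rep_eq plus_mseries.rep_eq)

text \<open>The value 0 outside \<open>V\<close> makes the function representing a choice of
  summands unique, so that cardinalities count choices.\<close>

definition decompositions ::
    "'v set \<Rightarrow> ('v \<Rightarrow> 'a \<Rightarrow> bool) \<Rightarrow> 'a \<Rightarrow> ('v \<Rightarrow> 'a :: comm_monoid_add) set" where
  "decompositions V P m =
     {F. (\<forall>v\<in>V. P v (F v)) \<and> (\<forall>v. v \<notin> V \<longrightarrow> F v = 0) \<and> (\<Sum>v\<in>V. F v) = m}"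

text \<open>All coefficients of the factors are 0 or 1, so each way of picking one monomial per
  factor with product \<open>m\<close> contributes 1. Finiteness is carried through the same
  induction because \<open>card\<close> is 0 on infinite sets.\<close>

lemma mcoeff_prod_indicators:
  fixes f :: "'v \<Rightarrow> mseries"
  assumes "finite V" "\<And>v m. v \<in> V \<Longrightarrow> mcoeff (f v) m = of_bool (P v m)"
  shows "finite (decompositions V P m) \<and>
    mcoeff (\<Prod>v\<in>V. f v) m = of_nat (card (decompositions V P m))"
  using assms
proof (induction V arbitrary: m rule: finite_induct)
  case empty
  have "decompositions {} P m = (if m = 0 then {\<lambda>_. 0} else {})"
    by (auto simp: decompositions_def)
  then show ?case by (simp add: one_mseries.rep_eq)
next
  case (insert v V)
  note IH = insert.IH[OF insert.prems, simplified]
  let ?D = "{(a, b). a + b = m \<and> P v a}"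
  let ?S = "Sigma ?D (\<lambda>(a, b). decompositions V P b)"
  have finD: "finite ?D"
    by (rule finite_subset[OF _ finite_decomp[of m]]) auto
  have finS: "finite ?S"
    using finD IH by auto
  have sum_upd: "(\<Sum>u\<in>V. if u = v then a else F u) = (\<Sum>u\<in>V. F u)" for F :: "'v \<Rightarrow> nat \<Rightarrow>\<^sub>0 nat" and a
    using insert.hyps by (intro sum.cong) auto
  \<comment> \<open>A decomposition over \<open>insert v V\<close> is the exponent \<open>a\<close>
    at \<open>v\<close>, the remainder \<open>b\<close>, and a decomposition of \<open>b\<close>
    over \<open>V\<close>.\<close>
  have bij: "bij_betw (\<lambda>(p, F). F(v := fst p)) ?S (decompositions (insert v V) P m)"
  proof (rule bij_betw_byWitness[where f' = "\<lambda>F. ((F v, \<Sum>u\<in>V. F u), F(v := 0))"], goal_cases)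
    case 1
    then show ?case
      using insert.hyps by (auto simp: decompositions_def sum_upd fun_eq_iff)
  next
    case 2
    then show ?case by auto
  next
    case 3
    then show ?case
      using insert.hyps by (auto simp: decompositions_def sum_upd split: if_splits)
  next
    case 4
    then show ?case
      using insert.hyps by (auto simp: decompositions_def sum_upd split: if_splits)
  qed
  have "mcoeff (\<Prod>u\<in>insert v V. f u) m =
      (\<Sum>(a, b)\<in>{(a, b). a + b = m}. of_bool (P v a) * of_nat (card (decompositions V P b)))"
    using insert.hyps insert.prems IH by (simp add: mcoeff_times)
  also have "\<dots> = (\<Sum>(a, b)\<in>?D. of_nat (card (decompositions V P b)))"
    by (rule sum.mono_neutral_cong_right) (auto simp: finite_decomp)
  also have "\<dots> = of_nat (card ?S)"
    using finD IH by (subst card_SigmaI) (auto simp: case_prod_beta)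
  also have "card ?S = card (decompositions (insert v V) P m)"
    using bij by (rule bij_betw_same_card)
  finally show ?case
    using finS bij bij_betw_finite by blast
qed

subsection \<open>Colourings and power sums\<close>

text \<open>The exponent vector of the monomial obtained by multiplying the variables with indices
  \<open>w i\<close> for \<open>i\<close> in \<open>A\<close>.\<close>

definition colour_content :: "'i set \<Rightarrow> ('i \<Rightarrow> nat) \<Rightarrow> (nat \<Rightarrow>\<^sub>0 nat)" where
  "colour_content A w = (\<Sum>i\<in>A. Poly_Mapping.single (w i) 1)"

definition colourings :: "nat \<Rightarrow> (nat \<Rightarrow>\<^sub>0 nat) \<Rightarrow> (nat \<Rightarrow> nat) set" where
  "colourings n m = {w \<in> {1..n} \<rightarrow>\<^sub>E UNIV. colour_content {1..n} w = m}"

lemma lookup_colour_content: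
  assumes "finite A"
  shows "Poly_Mapping.lookup (colour_content A w) c = card {i \<in> A. w i = c}"
proof -
  have "Poly_Mapping.lookup (colour_content A w) c = (\<Sum>i\<in>A. if w i = c then 1 else 0)"
    unfolding colour_content_def lookup_sum by (intro sum.cong) (auto simp: lookup_single when_def)
  then show ?thesis using assms by (simp add: sum.If_cases Int_def)
qed

lemma colour_content_const:
  assumes "\<And>i. i \<in> A \<Longrightarrow> w i = c"
  shows "colour_content A w = Poly_Mapping.single c (card A)"
proof (cases "finite A")
  case True
  then show ?thesis
    using assms
    by (intro poly_mapping_eqI) (auto simp: lookup_colour_content lookup_single when_def
      intro!: arg_cong[of _ _ card])
qed (simp add: colour_content_def)

lemma finite_colourings: "finite (colourings n m)"
proof (rule finite_subset)
  show "colourings n m \<subseteq> {1..n} \<rightarrow>\<^sub>E Poly_Mapping.keys m"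
  proof (intro subsetI PiE_I)
    fix w i assume w: "w \<in> colourings n m" and i: "i \<in> {1..n}"
    have m: "m = colour_content {1..n} w"
      using w by (simp add: colourings_def)
    show "w i \<in> Poly_Mapping.keys m"
      unfolding m in_keys_iff lookup_colour_content[OF finite_atLeastAtMost]
      using i by (auto simp: card_eq_0_iff)
  qed (auto simp: colourings_def)
qed (auto intro: finite_PiE)

lemma permute_eq_self_iff:
  assumes "\<sigma> permutes S"
  shows "permute \<sigma> w = w \<longleftrightarrow> (\<forall>i. w (\<sigma> i) = w i)"
proof
  assume "permute \<sigma> w = w"
  then have "w (\<sigma> i) = (w \<circ> inv' \<sigma>) (\<sigma> i)" for i
    by (simp add: permute_def)
  then show "\<forall>i. w (\<sigma> i) = w i"
    using assms by (simp add: permutes_inverses)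
next
  assume *: "\<forall>i. w (\<sigma> i) = w i"
  show "permute \<sigma> w = w"
  proof
    fix i
    show "permute \<sigma> w i = w i"
      using *[rule_format, of "inv' \<sigma> i"] assms by (simp add: permute_def permutes_inverses)
  qed
qed

lemma orbit_eq_iff:
  assumes "\<sigma> permutes {1..n :: nat}"
  shows "Orbits.orbit \<sigma> i = Orbits.orbit \<sigma> j \<longleftrightarrow> i \<in> Orbits.orbit \<sigma> j"
proof
  have "permutation \<sigma>"
    using assms permutation_permutes by blast
  then show "i \<in> Orbits.orbit \<sigma> j" if "Orbits.orbit \<sigma> i = Orbits.orbit \<sigma> j"
    using that permutation_self_in_orbit[of \<sigma> i] by simp
next
  show "Orbits.orbit \<sigma> i = Orbits.orbit \<sigma> j" if "i \<in> Orbits.orbit \<sigma> j"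
    using that cyclic_on_orbit[OF assms] by (intro orbit_cyclic_eq3) auto
qed

text \<open>Expanding the product selects for each cycle \<open>c\<close> a variable, raised to the
  power \<open>card c\<close>. Such a selection is a colouring constant on cycles, that is, one
  fixed by \<open>\<sigma>\<close>.\<close>

lemma mcoeff_p_part:
  assumes \<sigma>: "\<sigma> permutes {1..n}"
  shows "mcoeff (p_part (cycle_type n \<sigma>)) m =
    of_nat (card {w \<in> colourings n m. permute \<sigma> w = w})"
proof -
  let ?orb = "Orbits.orbit \<sigma>"
  let ?O = "?orb ` {1..n}"
  let ?P = "\<lambda>c a. \<exists>j. a = Poly_Mapping.single j (card c)"
  \<comment> \<open>The content of the colouring on each cycle, with the default 0 that
    \<open>decompositions\<close> prescribes elsewhere.\<close>
  define \<Phi> where "\<Phi> = (\<lambda>w c. if c \<in> ?O then colour_content c w else 0)"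
  have self: "i \<in> ?orb i" for i
    using orbit_eq_iff[OF \<sigma>] by blast
  have orb_eq: "?orb i = c" if "c \<in> ?O" "i \<in> c" for i c
    using that orbit_eq_iff[OF \<sigma>] by auto
  have sub: "?orb i \<subseteq> {1..n}" if "i \<in> {1..n}" for i
    using permutes_orbit_subset[OF \<sigma> that] .
  have fin: "finite c" if "c \<in> ?O" for c
    using that sub finite_subset by (metis (no_types, lifting) finite_atLeastAtMost imageE)
  have card0: "card (?orb i) \<noteq> 0" if "i \<in> {1..n}" for i
    using self[of i] fin[of "?orb i"] that by auto
  have Un: "\<Union>?O = {1..n}"
    using self sub by blast
  have sum_orbits: "(\<Sum>c\<in>?O. colour_content c w) = colour_content {1..n} w" for w
  proof -
    have "c \<inter> d = {}" if "c \<in> ?O" "d \<in> ?O" "c \<noteq> d" for c d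
    proof (rule equals0I)
      fix i assume "i \<in> c \<inter> d"
      then show False
        using orb_eq[OF that(1), of i] orb_eq[OF that(2), of i] that(3) by simp
    qed
    then have "\<forall>c\<in>?O. \<forall>d\<in>?O. c \<noteq> d \<longrightarrow> c \<inter> d = {}"
      by (intro ballI impI)
    moreover have "\<forall>c\<in>?O. finite c"
      by (intro ballI fin)
    ultimately show ?thesis
      using sum.Union_disjoint[of ?O "\<lambda>i. Poly_Mapping.single (w i) (1 :: nat)"]
      unfolding colour_content_def Un comp_def by simp
  qed
  have const: "w j = w i" if "\<forall>i. w (\<sigma> i) = w i" "j \<in> ?orb i" for w :: "nat \<Rightarrow> nat" and i j
    using that(2,1) by induction auto
  \<comment> \<open>Indexing the product by the cycles themselves keeps separate factors for cycles
    of equal length.\<close>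
  have "p_part (cycle_type n \<sigma>) = (\<Prod>c\<in>?O. power_sum (card c))"
    by (simp add: p_part_def cycle_type_def prod_unfold_prod_mset image_mset.compositionality comp_def)
  then have "mcoeff (p_part (cycle_type n \<sigma>)) m = of_nat (card (decompositions ?O ?P m))"
    using mcoeff_prod_indicators[of ?O "\<lambda>c. power_sum (card c)" ?P m]
    by (simp add: power_sum.rep_eq)
  also have "card (decompositions ?O ?P m) = card {w \<in> colourings n m. permute \<sigma> w = w}"
  proof (rule bij_betw_same_card[symmetric], rule bij_betw_imageI[of \<Phi>])
    have val: "\<Phi> w (?orb i) = Poly_Mapping.single (w i) (card (?orb i))"
      if "i \<in> {1..n}" "\<forall>i. w (\<sigma> i) = w i" for w i
    proof -
      have "colour_content (?orb i) w = Poly_Mapping.single (w i) (card (?orb i))"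
        by (rule colour_content_const) (rule const[OF that(2)])
      then show ?thesis
        using imageI[OF that(1), of ?orb] by (simp only: \<Phi>_def if_True)
    qed
    show "inj_on \<Phi> {w \<in> colourings n m. permute \<sigma> w = w}"
    proof (rule inj_onI)
      fix w w'
      assume "w \<in> {w \<in> colourings n m. permute \<sigma> w = w}"
        and "w' \<in> {w \<in> colourings n m. permute \<sigma> w = w}" and eq: "\<Phi> w = \<Phi> w'"
      then have w: "w \<in> colourings n m" "\<forall>i. w (\<sigma> i) = w i"
        and w': "w' \<in> colourings n m" "\<forall>i. w' (\<sigma> i) = w' i"
        by (simp_all add: permute_eq_self_iff[OF \<sigma>])
      have "w i = w' i" if "i \<in> {1..n}" for i
      proof -
        have "Poly_Mapping.single (w i) (card (?orb i)) = Poly_Mapping.single (w' i) (card (?orb i))"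
          using val[OF that w(2)] val[OF that w'(2)] eq by simp
        \<comment> \<open>The support recovers the colour, as cycle lengths are nonzero.\<close>
        then have "Poly_Mapping.keys (Poly_Mapping.single (w i) (card (?orb i))) =
            Poly_Mapping.keys (Poly_Mapping.single (w' i) (card (?orb i)))"
          by (rule arg_cong)
        then show ?thesis using card0[OF that] by simp
      qed
      then show "w = w'"
        using w(1) w'(1) unfolding colourings_def
        by (auto intro!: PiE_ext[of w "{1..n}" "\<lambda>_. UNIV" w'])
    qed
    show "\<Phi> ` {w \<in> colourings n m. permute \<sigma> w = w} = decompositions ?O ?P m"
    proof (intro equalityI subsetI)
      fix F assume "F \<in> \<Phi> ` {w \<in> colourings n m. permute \<sigma> w = w}"
      then obtain w where w: "w \<in> colourings n m" "\<forall>i. w (\<sigma> i) = w i" and F: "F = \<Phi> w"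
        by (auto simp: permute_eq_self_iff[OF \<sigma>])
      have "(\<Sum>c\<in>?O. F c) = (\<Sum>c\<in>?O. colour_content c w)"
        unfolding F \<Phi>_def by (intro sum.cong refl) (simp only: if_True)
      then have "(\<Sum>c\<in>?O. F c) = m"
        using w sum_orbits by (simp add: colourings_def)
      moreover have "?P c (F c)" if "c \<in> ?O" for c
      proof -
        from that obtain i where i: "i \<in> {1..n}" and c: "c = ?orb i" by (rule imageE)
        show ?thesis unfolding c F using val[OF i w(2)] by blast
      qed
      ultimately show "F \<in> decompositions ?O ?P m"
        by (simp add: decompositions_def) (simp add: F \<Phi>_def)
    next
      fix F assume F: "F \<in> decompositions ?O ?P m"
      then have "\<forall>c. \<exists>j. c \<in> ?O \<longrightarrow> F c = Poly_Mapping.single j (card c)"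
        by (auto simp: decompositions_def)
      then obtain J where J: "F c = Poly_Mapping.single (J c) (card c)" if "c \<in> ?O" for c
        by metis
      define w where "w = (\<lambda>i\<in>{1..n}. J (?orb i))"
      have con: "colour_content c w = F c" if "c \<in> ?O" for c
        unfolding J[OF that]
      proof (rule colour_content_const)
        fix i assume i: "i \<in> c"
        then have "i \<in> {1..n}" using Un that by blast
        then show "w i = J c" using orb_eq[OF that i] by (simp add: w_def)
      qed
      then have F\<Phi>: "F = \<Phi> w"
        using F by (auto simp: decompositions_def \<Phi>_def fun_eq_iff simp del: image_iff)
      have "colour_content {1..n} w = m"
        using F con sum_orbits[of w] by (simp add: decompositions_def)
      moreover have "w (\<sigma> i) = w i" for i
      proof (cases "i \<in> {1..n}")
        case True
        have "?orb (\<sigma> i) = ?orb i"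
          using orbit_eq_iff[OF \<sigma>] orbit.base[of \<sigma> i] by blast
        then show ?thesis
          using True permutes_in_image[OF \<sigma>, of i] by (simp add: w_def del: atLeastAtMost_iff)
      next
        case False
        then show ?thesis using permutes_not_in[OF \<sigma>, of i] by simp
      qed
      moreover have "w \<in> {1..n} \<rightarrow>\<^sub>E UNIV"
        by (simp add: w_def)
      ultimately have "w \<in> {w \<in> colourings n m. permute \<sigma> w = w}"
        by (simp add: colourings_def permute_eq_self_iff[OF \<sigma>])
      then show "F \<in> \<Phi> ` {w \<in> colourings n m. permute \<sigma> w = w}"
        using F\<Phi> by blast
    qed
  qed
  finally show ?thesis .
qed

subsection \<open>Counting orbits\<close>

text \<open>Restriction to \<open>Y\<close> yields the extensional maps of \<open>BijGroup\<close>,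
  which opens the way to \<open>burnside\<close>.\<close>

lemma group_action_of_action_on:
  assumes "action_on G Y act"
  shows "group_action G Y (\<lambda>g. \<lambda>y\<in>Y. act g y)"
proof -
  interpret group G using assms by (simp add: action_on_def)
  have act: "act g y \<in> Y" "act \<one>\<^bsub>G\<^esub> y = y" "act (g \<otimes>\<^bsub>G\<^esub> h) y = act g (act h y)"
    if "g \<in> carrier G" "h \<in> carrier G" "y \<in> Y" for g h y
    using that assms by (auto simp: action_on_def)
  have inv: "act (inv\<^bsub>G\<^esub> g) (act g y) = y" "act g (act (inv\<^bsub>G\<^esub> g) y) = y"
    if "g \<in> carrier G" "y \<in> Y" for g y
    using that act(3)[of "inv\<^bsub>G\<^esub> g" g y] act(3)[of g "inv\<^bsub>G\<^esub> g" y] act(2)[of g g y] by auto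
  have bij: "bij_betw (act g) Y Y" if "g \<in> carrier G" for g
    by (rule bij_betw_byWitness[where f' = "act (inv\<^bsub>G\<^esub> g)"])
      (use that inv act(1) in auto)
  have "(\<lambda>g. \<lambda>y\<in>Y. act g y) \<in> hom G (BijGroup Y)"
    using bij act by (auto simp: hom_def BijGroup_def Bij_def compose_def fun_eq_iff)
  then show ?thesis
    by (simp add: group_action_def group_hom_def group_hom_axioms_def group_BijGroup)
qed

text \<open>Burnside's lemma, with orbits replaced by the values of a complete invariant
  \<open>\<pi>\<close>: the orbits are exactly its fibres.\<close>

lemma sum_card_fixpoints:
  assumes act: "action_on G Y act" and fin: "finite (carrier G)" "finite Y"
    and inv: "\<And>y z. y \<in> Y \<Longrightarrow> z \<in> Y \<Longrightarrow> \<pi> y = \<pi> z \<longleftrightarrow> (\<exists>g\<in>carrier G. act g y = z)"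
  shows "(\<Sum>g\<in>carrier G. card {y \<in> Y. act g y = y}) = card (\<pi> ` Y) * card (carrier G)"
proof -
  let ?act = "\<lambda>g. \<lambda>y\<in>Y. act g y"
  interpret group_action G Y ?act
    by (rule group_action_of_action_on[OF act])
  have clo: "act g y \<in> Y" if "g \<in> carrier G" "y \<in> Y" for g y
    using act that by (auto simp: action_on_def)
  have orb: "Group_Action.orbit G ?act y = {z \<in> Y. \<pi> z = \<pi> y}" if "y \<in> Y" for y
    using that inv[of y] clo by (fastforce simp: Group_Action.orbit_def)
  have "(\<lambda>z. {y \<in> Y. \<pi> y = z}) ` (\<pi> ` Y) = orbits G Y ?act"
    using orb by (auto simp: orbits_def image_iff)
  moreover have "inj_on (\<lambda>z. {y \<in> Y. \<pi> y = z}) (\<pi> ` Y)"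
    by (auto intro!: inj_onI)
  from card_image[OF this] have "card ((\<lambda>z. {y \<in> Y. \<pi> y = z}) ` (\<pi> ` Y)) = card (\<pi> ` Y)" .
  ultimately have "card (orbits G Y ?act) = card (\<pi> ` Y)"
    by simp
  moreover have "invariants Y ?act g = {y \<in> Y. act g y = y}" for g
    by (auto simp: invariants_def)
  ultimately show ?thesis
    using burnside[OF fin] by (simp add: order_def)
qed

subsection \<open>The Frobenius characteristic of a permutation representation on tuples\<close>

lemma permute_comp:
  assumes "\<sigma> permutes S" "\<tau> permutes S"
  shows "permute (\<sigma> \<circ> \<tau>) x = permute \<sigma> (permute \<tau> x)"
  using assms by (simp add: permute_def o_inv_distrib permutes_bij comp_assoc)

lemma permute_id [simp]: "permute id x = x"
  by (simp add: permute_def)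

lemma permute_inverse:
  assumes "\<sigma> permutes S"
  shows "permute \<sigma> (permute (inv' \<sigma>) x) = x" "permute (inv' \<sigma>) (permute \<sigma> x) = x"
  using permute_comp[OF assms permutes_inv[OF assms], of x]
    permute_comp[OF permutes_inv[OF assms] assms, of x] assms
  by (simp_all add: permutes_inv_o)

lemma action_on_permute:
  assumes "\<And>\<sigma> x. \<sigma> permutes {1..n} \<Longrightarrow> x \<in> X \<Longrightarrow> permute \<sigma> x \<in> X"
  shows "action_on (sym_group n) X permute"
  unfolding action_on_def sym_group_carrier sym_group_mult sym_group_one
  using assms sym_group_is_group[of n] by (simp add: permute_comp[of _ "{1..n}"] sym_group_carrier)

lemma card_permute_fiber:
  assumes "\<sigma> permutes S"
  shows "card {i \<in> S. P (inv' \<sigma> i)} = card {i \<in> S. P i}"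
proof -
  have "\<sigma> ` {i \<in> S. P i} = {i \<in> S. P (inv' \<sigma> i)}"
  proof (intro equalityI subsetI)
    fix j assume "j \<in> {i \<in> S. P (inv' \<sigma> i)}"
    then have "inv' \<sigma> j \<in> {i \<in> S. P i}" "\<sigma> (inv' \<sigma> j) = j"
      using assms permutes_in_image[OF permutes_inv[OF assms], of j]
      by (simp_all add: permutes_inverses)
    then show "j \<in> \<sigma> ` {i \<in> S. P i}"
      by (intro image_eqI[of _ _ "inv' \<sigma> j"]) simp_all
  next
    fix j assume "j \<in> \<sigma> ` {i \<in> S. P i}"
    then obtain i where "i \<in> S" "P i" "j = \<sigma> i" by blast
    then show "j \<in> {i \<in> S. P (inv' \<sigma> i)}"
      using assms by (simp add: permutes_in_image permutes_inverses)
  qed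
  then show ?thesis
    using card_image[OF permutes_inj_on[OF assms], of "{i \<in> S. P i}"] by simp
qed

lemma permute_PiE:
  assumes "\<sigma> permutes S" "x \<in> S \<rightarrow>\<^sub>E T"
  shows "permute \<sigma> x \<in> S \<rightarrow>\<^sub>E T"
proof (rule PiE_I)
  have \<sigma>': "inv' \<sigma> permutes S" using assms(1) by (rule permutes_inv)
  show "permute \<sigma> x i \<in> T" if "i \<in> S" for i
    using that permutes_in_image[OF \<sigma>', of i] assms(2) by (auto simp: permute_def)
  show "permute \<sigma> x i = undefined" if "i \<notin> S" for i
    using that permutes_not_in[OF \<sigma>', of i] assms(2) by (auto simp: permute_def)
qed

lemma colour_content_permute:
  assumes "\<sigma> permutes S" "finite S"
  shows "colour_content {i \<in> S. P (inv' \<sigma> i)} (permute \<sigma> w) = colour_content {i \<in> S. P i} w"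
proof (rule poly_mapping_eqI)
  fix c
  have "{i \<in> {i \<in> S. P (inv' \<sigma> i)}. permute \<sigma> w i = c} =
      {i \<in> S. P (inv' \<sigma> i) \<and> w (inv' \<sigma> i) = c}"
    by (auto simp: permute_def)
  then show "Poly_Mapping.lookup (colour_content {i \<in> S. P (inv' \<sigma> i)} (permute \<sigma> w)) c =
      Poly_Mapping.lookup (colour_content {i \<in> S. P i} w) c"
    using assms card_permute_fiber[OF assms(1), of "\<lambda>i. P i \<and> w i = c"]
    by (simp add: lookup_colour_content conj_assoc)
qed

lemma permute_in_colourings:
  assumes "\<sigma> permutes {1..n}" "w \<in> colourings n m"
  shows "permute \<sigma> w \<in> colourings n m"
  using assms(2) permute_PiE[OF assms(1), of w UNIV]
    colour_content_permute[OF assms(1), of "\<lambda>_. True" w]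
  by (simp add: colourings_def del: atLeastAtMost_iff)

lemma permute_eqI:
  assumes "x \<in> S \<rightarrow>\<^sub>E T" "y \<in> S \<rightarrow>\<^sub>E T'" "p permutes S" "\<forall>i\<in>S. x i = y (p i)"
  shows "permute p x = y"
proof
  fix i
  have p': "inv' p permutes S" using assms(3) by (rule permutes_inv)
  show "permute p x i = y i"
  proof (cases "i \<in> S")
    case True
    then have "inv' p i \<in> S" using permutes_in_image[OF p'] by simp
    then show ?thesis
      using assms(3,4) by (simp add: permute_def permutes_inverses)
  next
    case False
    then show ?thesis
      using permutes_not_in[OF p' False] PiE_arb[OF assms(1) False] PiE_arb[OF assms(2) False]
      by (simp add: permute_def)
  qed
qed

text \<open>A complete invariant of the pair under simultaneous permutation. As a function of the
  value \<open>v\<close> it is also a decomposition of the content of \<open>w\<close>, which links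
  it to products of complete homogeneous functions.\<close>

definition fibre_content :: "nat \<Rightarrow> (nat \<Rightarrow> 'a) \<times> (nat \<Rightarrow> nat) \<Rightarrow> 'a \<Rightarrow> nat \<Rightarrow>\<^sub>0 nat" where
  "fibre_content n = (\<lambda>(x, w) v. colour_content {i \<in> {1..n}. x i = v} w)"

lemma fibre_content_permute:
  assumes "\<sigma> permutes {1..n}"
  shows "fibre_content n (permute \<sigma> x, permute \<sigma> w) = fibre_content n (x, w)"
proof
  fix v
  have "{i \<in> {1..n}. permute \<sigma> x i = v} = {i \<in> {1..n}. x (inv' \<sigma> i) = v}"
    by (auto simp: permute_def)
  then show "fibre_content n (permute \<sigma> x, permute \<sigma> w) v = fibre_content n (x, w) v"
    using colour_content_permute[OF assms, of "\<lambda>i. x i = v" w] by (simp add: fibre_content_def)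
qed

text \<open>Equal fibre contents say that the multisets of the pairs \<open>(x i, w i)\<close>
  agree, and a permutation of the indices then matches them.\<close>

lemma fibre_content_eq_iff:
  assumes "x \<in> {1..n} \<rightarrow>\<^sub>E UNIV" "y \<in> {1..n} \<rightarrow>\<^sub>E UNIV" "w \<in> {1..n} \<rightarrow>\<^sub>E UNIV" "u \<in> {1..n} \<rightarrow>\<^sub>E UNIV"
  shows "fibre_content n (x, w) = fibre_content n (y, u) \<longleftrightarrow>
    (\<exists>\<sigma>. \<sigma> permutes {1..n} \<and> permute \<sigma> x = y \<and> permute \<sigma> w = u)" (is "?L \<longleftrightarrow> ?R")
proof
  assume ?L
  have count: "count (image_mset (\<lambda>i. (x i, w i)) (mset_set {1..n})) (v, c) =
      Poly_Mapping.lookup (fibre_content n (x, w) v) c" for x :: "nat \<Rightarrow> 'a" and w v c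
    by (auto simp: count_image_mset fibre_content_def lookup_colour_content vimage_def
        intro!: arg_cong[of _ _ card])
  have "image_mset (\<lambda>i. (x i, w i)) (mset_set {1..n}) = image_mset (\<lambda>i. (y i, u i)) (mset_set {1..n})"
  proof (rule multiset_eqI)
    fix p :: "'a \<times> nat"
    show "count (image_mset (\<lambda>i. (x i, w i)) (mset_set {1..n})) p =
        count (image_mset (\<lambda>i. (y i, u i)) (mset_set {1..n})) p"
      using \<open>?L\<close> count[of x w "fst p" "snd p"] count[of y u "fst p" "snd p"] by simp
  qed
  from image_mset_eq_implies_permutes[OF finite_atLeastAtMost this]
  obtain p where p: "p permutes {1..n}" "\<forall>i\<in>{1..n}. (x i, w i) = (y (p i), u (p i))" .
  then have "permute p x = y" "permute p w = u"
    using permute_eqI[of x "{1..n}" UNIV y UNIV p] permute_eqI[of w "{1..n}" UNIV u UNIV p] assms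
    by auto
  with p(1) show ?R by blast
next
  assume ?R
  then show ?L using fibre_content_permute by metis
qed

text \<open>The coefficient is the average over \<open>\<sigma>\<close> of fixed points in
  \<open>X\<close> times fixed colourings, that is, of fixed pairs. Burnside's lemma turns it into
  the number of orbits of pairs.\<close>

lemma mcoeff_Frob_permute:
  assumes fin: "finite X" and ext: "X \<subseteq> {1..n} \<rightarrow>\<^sub>E UNIV"
    and clo: "\<And>\<sigma> x. \<sigma> permutes {1..n} \<Longrightarrow> x \<in> X \<Longrightarrow> permute \<sigma> x \<in> X"
  shows "mcoeff (Frob n (perm_rep X permute)) m =
    of_nat (card (fibre_content n ` (X \<times> colourings n m)))"
proof -
  let ?S = "carrier (sym_group n)" and ?Y = "X \<times> colourings n m"
  let ?act = "\<lambda>\<sigma> (x, w). (permute \<sigma> x, permute \<sigma> w)"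
  have S: "?S = {\<sigma>. \<sigma> permutes {1..n}}"
    by (simp add: sym_group_def)
  have finS: "finite ?S" and cardS: "card ?S = fact n"
    by (simp_all add: S finite_permutations card_permutations)
  have act: "action_on (sym_group n) ?Y ?act"
    unfolding action_on_def sym_group_carrier sym_group_mult sym_group_one
    using clo sym_group_is_group[of n] permute_in_colourings[of _ n _ m]
    by (auto simp: permute_comp[of _ "{1..n}"] sym_group_carrier)
  have inv: "fibre_content n y = fibre_content n z \<longleftrightarrow> (\<exists>g\<in>?S. ?act g y = z)"
    if "y \<in> ?Y" "z \<in> ?Y" for y z
  proof -
    have "fst y \<in> {1..n} \<rightarrow>\<^sub>E UNIV" "fst z \<in> {1..n} \<rightarrow>\<^sub>E UNIV"
      "snd y \<in> {1..n} \<rightarrow>\<^sub>E UNIV" "snd z \<in> {1..n} \<rightarrow>\<^sub>E UNIV"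
      using that ext unfolding mem_Times_iff colourings_def by blast+
    from fibre_content_eq_iff[OF this] show ?thesis
      unfolding sym_group_carrier Bex_def by (cases y; cases z) simp
  qed
  have card_fix: "card {y \<in> ?Y. ?act \<sigma> y = y} =
      card {x \<in> X. permute \<sigma> x = x} * card {w \<in> colourings n m. permute \<sigma> w = w}" for \<sigma>
  proof -
    have "{y \<in> ?Y. ?act \<sigma> y = y} =
        {x \<in> X. permute \<sigma> x = x} \<times> {w \<in> colourings n m. permute \<sigma> w = w}"
      by auto
    then show ?thesis by (simp add: card_cartesian_product)
  qed
  have "mcoeff (Frob n (perm_rep X permute)) m = 1 / fact n *
      (\<Sum>\<sigma>\<in>?S. of_nat (card {x \<in> X. permute \<sigma> x = x}) *
        of_nat (card {w \<in> colourings n m. permute \<sigma> w = w}))"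
    unfolding Frob_def mcoeff_mconst_times mcoeff_sum
    by (intro arg_cong2[of _ _ _ _ "(*)"] sum.cong refl)
      (auto simp: S mcoeff_p_part rep_character_perm_rep[OF fin clo])
  also have "\<dots> = 1 / fact n * of_nat (\<Sum>\<sigma>\<in>?S. card {y \<in> ?Y. ?act \<sigma> y = y})"
    by (simp add: card_fix)
  also have "\<dots> = of_nat (card (fibre_content n ` ?Y))"
    using sum_card_fixpoints[OF act finS _ inv] fin by (simp add: cardS finite_colourings)
  finally show ?thesis .
qed

text \<open>An equivariant bijection matches the fixed points of every group element, so the
  characters coincide.\<close>

lemma Frob_perm_rep_bij:
  assumes "finite X" "bij_betw \<phi> X Y"
    and "\<And>\<sigma> x. \<sigma> \<in> carrier (sym_group n) \<Longrightarrow> x \<in> X \<Longrightarrow> act \<sigma> x \<in> X"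
    and eq: "\<And>\<sigma> x. \<sigma> \<in> carrier (sym_group n) \<Longrightarrow> x \<in> X \<Longrightarrow> \<phi> (act \<sigma> x) = act' \<sigma> (\<phi> x)"
  shows "Frob n (perm_rep X act) = Frob n (perm_rep Y act')"
proof -
  have Y: "Y = \<phi> ` X" and inj: "inj_on \<phi> X"
    using assms(2) by (auto simp: bij_betw_def)
  have "rep_character (perm_rep X act) \<sigma> = rep_character (perm_rep Y act') \<sigma>"
    if \<sigma>: "\<sigma> \<in> carrier (sym_group n)" for \<sigma>
  proof -
    have "{y \<in> Y. act' \<sigma> y = y} = \<phi> ` {x \<in> X. act \<sigma> x = x}"
    proof (intro equalityI subsetI)
      fix y assume "y \<in> {y \<in> Y. act' \<sigma> y = y}"
      then obtain x where x: "x \<in> X" "y = \<phi> x" "\<phi> (act \<sigma> x) = \<phi> x"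
        using eq[OF \<sigma>] by (auto simp: Y)
      then have "act \<sigma> x = x"
        using assms(3)[OF \<sigma>] inj by (simp add: inj_on_eq_iff)
      with x show "y \<in> \<phi> ` {x \<in> X. act \<sigma> x = x}" by blast
    next
      fix y assume "y \<in> \<phi> ` {x \<in> X. act \<sigma> x = x}"
      then obtain x where "x \<in> X" "act \<sigma> x = x" "y = \<phi> x" by auto
      then show "y \<in> {y \<in> Y. act' \<sigma> y = y}"
        using eq[OF \<sigma>, of x] by (simp add: Y)
    qed
    then have "card {y \<in> Y. act' \<sigma> y = y} = card {x \<in> X. act \<sigma> x = x}"
      using inj_on_subset[OF inj, of "{x \<in> X. act \<sigma> x = x}"] by (simp add: card_image)
    moreover have "act' \<sigma> y \<in> Y" if "y \<in> Y" for y
    proof -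
      from that obtain x where x: "x \<in> X" "y = \<phi> x" by (auto simp: Y)
      show ?thesis
        using eq[OF \<sigma> x(1), symmetric] assms(3)[OF \<sigma> x(1)] x(2) by (simp add: Y)
    qed
    ultimately show ?thesis
      using assms(1,3) \<sigma> by (simp add: rep_character_perm_rep Y)
  qed
  then show ?thesis
    unfolding Frob_def by (simp cong: sum.cong)
qed

subsection \<open>Complete homogeneous symmetric functions\<close>

lemma mdegree_add: "mdegree (a + b) = mdegree a + mdegree b"
proof -
  let ?K = "Poly_Mapping.keys a \<union> Poly_Mapping.keys b"
  have *: "mdegree c = (\<Sum>i\<in>?K. Poly_Mapping.lookup c i)" if "Poly_Mapping.keys c \<subseteq> ?K" for c
    unfolding mdegree_def using that by (intro sum.mono_neutral_left) (auto simp: in_keys_iff)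
  show ?thesis
    using Poly_Mapping.keys_add[of a b] by (simp add: * lookup_add sum.distrib)
qed

lemma mdegree_colour_content: "finite A \<Longrightarrow> mdegree (colour_content A w) = card A"
proof (induction A rule: finite_induct)
  case (insert i A)
  then show ?case
    by (simp add: colour_content_def mdegree_add) (simp add: mdegree_def)
qed (simp add: colour_content_def mdegree_def)

text \<open>Each new index takes a colour that still occurs in \<open>a\<close>, and this colour is
  then divided out once.\<close>

lemma ex_colour_content:
  assumes "finite A" "mdegree a = card A"
  shows "\<exists>w. colour_content A w = a"
  using assms
proof (induction A arbitrary: a rule: finite_induct)
  case empty
  then have "\<forall>i\<in>Poly_Mapping.keys a. Poly_Mapping.lookup a i = 0"
    by (simp add: mdegree_def)
  then have "a = 0"
    by (intro poly_mapping_eqI) (auto simp: in_keys_iff)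
  then show ?case by (simp add: colour_content_def)
next
  case (insert i A)
  then have "mdegree a \<noteq> 0" by simp
  then obtain c where c: "Poly_Mapping.lookup a c \<noteq> 0"
    by (auto simp: mdegree_def in_keys_iff)
  define b where "b = a - Poly_Mapping.single c 1"
  have a: "a = Poly_Mapping.single c 1 + b"
    using c by (intro poly_mapping_eqI) (auto simp: b_def lookup_add lookup_minus lookup_single when_def)
  have "mdegree b = card A"
    using insert by (simp add: a mdegree_add) (simp add: mdegree_def)
  then obtain w where w: "colour_content A w = b"
    using insert.IH by blast
  have "colour_content A (w(i := c)) = colour_content A w"
    unfolding colour_content_def using insert.hyps by (intro sum.cong) auto
  then have "colour_content (insert i A) (w(i := c)) = a"
    using insert.hyps w by (simp add: a) (simp add: colour_content_def)
  then show ?case by blast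
qed

text \<open>Expanding the product selects for each fibre of \<open>x\<close> a monomial whose degree
  is the size of the fibre. Every such monomial is the content of a colouring of that fibre.\<close>

lemma mcoeff_h_part:
  "mcoeff (h_part (mult_part n x)) m =
    of_nat (card (fibre_content n ` ({x} \<times> colourings n m)))"
proof -
  let ?V = "x ` {1..n}" and ?A = "\<lambda>v. {i \<in> {1..n}. x i = v}"
  let ?P = "\<lambda>v a. mdegree a = card (?A v)"
  have "h_part (mult_part n x) = (\<Prod>v\<in>?V. complete_homogeneous (card (?A v)))"
    by (simp add: h_part_def mult_part_def prod_unfold_prod_mset image_mset.compositionality comp_def)
  then have "mcoeff (h_part (mult_part n x)) m = of_nat (card (decompositions ?V ?P m))"
    using mcoeff_prod_indicators[of ?V "\<lambda>v. complete_homogeneous (card (?A v))" ?P m]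
    by (simp add: complete_homogeneous.rep_eq)
  also have "decompositions ?V ?P m = fibre_content n ` ({x} \<times> colourings n m)"
  proof (intro equalityI subsetI)
    fix F assume "F \<in> fibre_content n ` ({x} \<times> colourings n m)"
    then obtain w where w: "w \<in> colourings n m" and F: "F = fibre_content n (x, w)"
      by auto
    have "(\<Sum>v\<in>?V. F v) = colour_content {1..n} w"
      unfolding F fibre_content_def colour_content_def prod.case
      by (rule sum.image_gen[symmetric]) simp
    moreover have "F v = 0" if "v \<notin> ?V" for v
    proof -
      have "?A v = {}" using that by auto
      then show ?thesis unfolding F fibre_content_def prod.case colour_content_def by (simp only: sum.empty)
    qed
    ultimately show "F \<in> decompositions ?V ?P m"
      using w by (simp add: decompositions_def colourings_def)
        (simp add: F fibre_content_def mdegree_colour_content)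
  next
    fix F assume F: "F \<in> decompositions ?V ?P m"
    have "\<exists>w. colour_content (?A v) w = F v" for v
    proof (cases "v \<in> ?V")
      case True
      moreover have "\<forall>v\<in>?V. ?P v (F v)"
        using F unfolding decompositions_def by blast
      ultimately show ?thesis by (intro ex_colour_content) auto
    next
      case False
      then have "?A v = {}" by auto
      then have "colour_content (?A v) w = 0" for w
        unfolding colour_content_def by (simp only: sum.empty)
      then show ?thesis using F False by (simp add: decompositions_def)
    qed
    then obtain W where W: "colour_content (?A v) (W v) = F v" for v
      by metis
    \<comment> \<open>The fibres of \<open>x\<close> partition the indices, so the colourings of the
      fibres glue.\<close>
    define w where "w = (\<lambda>i\<in>{1..n}. W (x i) i)"
    have w: "colour_content (?A v) w = F v" for v
      unfolding W[symmetric] colour_content_def by (intro sum.cong) (auto simp: w_def)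
    then have "fibre_content n (x, w) = F"
      by (simp add: fibre_content_def)
    moreover have "colour_content {1..n} w = (\<Sum>v\<in>?V. F v)"
      unfolding w[symmetric] colour_content_def by (rule sum.image_gen) simp
    then have "w \<in> colourings n m"
      using F by (simp add: decompositions_def colourings_def) (simp add: w_def)
    ultimately show "F \<in> fibre_content n ` ({x} \<times> colourings n m)"
      by auto
  qed
  finally show ?thesis .
qed

subsection \<open>Sorting tuples\<close>

lemma mset_map_upt: "mset (map x [1..<Suc n]) = image_mset x (mset_set {1..n})"
proof -
  have "{1..<Suc n} = {1..n}" by auto
  then show ?thesis by (simp only: mset_map mset_upt)
qed

lemma ex_sorting_permutation:
  fixes x :: "nat \<Rightarrow> 'a :: linorder"
  shows "\<exists>\<sigma>. \<sigma> permutes {1..n} \<and> antimono_on {1..n} (permute \<sigma> x)"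
proof -
  let ?l = "rev (sort (map x [1..<Suc n]))"
  define y where "y i = ?l ! (i - 1)" for i
  have len: "length ?l = n" by simp
  have "map y [1..<Suc n] = ?l"
    by (rule nth_equalityI) (auto simp: y_def simp del: upt_Suc)
  then have "image_mset y (mset_set {1..n}) = image_mset x (mset_set {1..n})"
    using mset_map_upt[of y n] mset_map_upt[of x n] by (metis mset_rev mset_sort)
  from image_mset_eq_implies_permutes[OF finite_atLeastAtMost this]
  obtain p where p: "p permutes {1..n}" "\<forall>i\<in>{1..n}. y i = x (p i)" .
  have "sorted (rev ?l)" by simp
  then have y: "y i \<ge> y j" if "1 \<le> i" "i \<le> j" "j \<le> n" for i j
    using that len unfolding y_def by (intro sorted_rev_nth_mono) auto
  \<comment> \<open>\<open>permute\<close> composes with the inverse of its argument, hence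
    \<open>p\<close> enters inverted.\<close>
  have "antimono_on {1..n} (permute (inv' p) x)"
    using p y permutes_inv_inv[OF p(1)] by (intro monotone_onI) (auto simp: permute_def)
  then show ?thesis using permutes_inv[OF p(1)] by blast
qed

text \<open>A multiset has only one decreasing arrangement, so each orbit of tuples has a single
  decreasing representative.\<close>

lemma antimono_on_permute_eq:
  fixes x y :: "nat \<Rightarrow> 'a :: linorder"
  assumes "x \<in> {1..n} \<rightarrow>\<^sub>E UNIV" "y \<in> {1..n} \<rightarrow>\<^sub>E UNIV"
    and "antimono_on {1..n} x" "antimono_on {1..n} y"
    and "\<sigma> permutes {1..n}" "permute \<sigma> x = y"
  shows "x = y"
proof (rule PiE_ext[OF assms(1,2)])
  have sorted: "sorted (rev (map z [1..<Suc n]))" if "antimono_on {1..n} z" for z :: "nat \<Rightarrow> 'a"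
    unfolding sorted_rev_iff_nth_mono
    using that by (auto simp: monotone_on_def simp del: upt_Suc)
  have "image_mset y (mset_set {1..n}) = image_mset x (mset_set {1..n})"
  proof -
    have "image_mset y (mset_set {1..n}) = image_mset x (image_mset (inv' \<sigma>) (mset_set {1..n}))"
      using assms(6) by (auto simp: permute_def image_mset.compositionality)
    also have "image_mset (inv' \<sigma>) (mset_set {1..n}) = mset_set {1..n}"
      using permutes_inv[OF assms(5)] by (simp add: image_mset_mset_set permutes_inj_on permutes_image)
    finally show ?thesis .
  qed
  then have "mset (rev (map x [1..<Suc n])) = mset (rev (map y [1..<Suc n]))"
    using mset_map_upt[of x n] mset_map_upt[of y n] by simp
  then have "rev (map x [1..<Suc n]) = rev (map y [1..<Suc n])"
    using sorted[OF assms(3)] sorted[OF assms(4)] by (metis properties_for_sort)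
  then have "map x [1..<Suc n] = map y [1..<Suc n]"
    by (simp only: rev_is_rev_conv)
  then show "x i = y i" if "i \<in> {1..n}" for i
    using that by (auto simp del: upt_Suc)
qed

text \<open>The orbits of pairs are grouped by the decreasing representative of the first component;
  \<open>mcoeff_h_part\<close> counts each group.\<close>

lemma Frob_permute:
  fixes X :: "(nat \<Rightarrow> int) set"
  assumes fin: "finite X" and ext: "X \<subseteq> {1..n} \<rightarrow>\<^sub>E UNIV"
    and clo: "\<And>\<sigma> x. \<sigma> permutes {1..n} \<Longrightarrow> x \<in> X \<Longrightarrow> permute \<sigma> x \<in> X"
  shows "Frob n (perm_rep X permute) =
    (\<Sum>x\<in>{x \<in> X. antimono_on {1..n} x}. h_part (mult_part n x))"
proof (rule mseries_eqI)
  fix m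
  let ?D = "{x \<in> X. antimono_on {1..n} x}"
  let ?F = "\<lambda>x. fibre_content n ` ({x} \<times> colourings n m)"
  have disj: "?F x \<inter> ?F y = {}" if x: "x \<in> ?D" and y: "y \<in> ?D" and "x \<noteq> y" for x y
  proof (rule equals0I)
    fix F assume "F \<in> ?F x \<inter> ?F y"
    then obtain w u where w: "w \<in> colourings n m" and u: "u \<in> colourings n m"
      and eq: "fibre_content n (x, w) = fibre_content n (y, u)" by auto
    have "x \<in> {1..n} \<rightarrow>\<^sub>E UNIV" "y \<in> {1..n} \<rightarrow>\<^sub>E UNIV"
      using x y ext by auto
    moreover from this eq obtain \<sigma> where "\<sigma> permutes {1..n}" "permute \<sigma> x = y"
      using fibre_content_eq_iff[of x n y w u] w u by (auto simp: colourings_def)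
    ultimately have "x = y"
      using x y by (intro antimono_on_permute_eq[of x n y \<sigma>]) auto
    with \<open>x \<noteq> y\<close> show False ..
  qed
  have "fibre_content n ` (X \<times> colourings n m) = (\<Union>x\<in>?D. ?F x)"
  proof (intro equalityI subsetI)
    fix F assume "F \<in> fibre_content n ` (X \<times> colourings n m)"
    then obtain x w where x: "x \<in> X" and w: "w \<in> colourings n m" and F: "F = fibre_content n (x, w)"
      by auto
    obtain \<sigma> where \<sigma>: "\<sigma> permutes {1..n}" and mono: "antimono_on {1..n} (permute \<sigma> x)"
      using ex_sorting_permutation[of n x] by auto
    have "F = fibre_content n (permute \<sigma> x, permute \<sigma> w)"
      using fibre_content_permute[OF \<sigma>] F by metis
    then have "F \<in> ?F (permute \<sigma> x)"
      using permute_in_colourings[OF \<sigma> w] by blast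
    then show "F \<in> (\<Union>x\<in>?D. ?F x)"
      using clo[OF \<sigma> x] mono by blast
  qed auto
  then have "card (fibre_content n ` (X \<times> colourings n m)) = (\<Sum>x\<in>?D. card (?F x))"
    using disj fin by (simp only:) (rule card_UN_disjoint, auto simp: finite_colourings)
  then show "mcoeff (Frob n (perm_rep X permute)) m =
      mcoeff (\<Sum>x\<in>?D. h_part (mult_part n x)) m"
    unfolding mcoeff_Frob_permute[OF fin ext clo, simplified] mcoeff_sum mcoeff_h_part by simp
qed

subsection \<open>Lattice points of the permutohedron\<close>

lemma lookup_scaleR_poly_mapping:
  "Poly_Mapping.lookup (r *\<^sub>R f) i = r *\<^sub>R Poly_Mapping.lookup f i"
  for f :: "'a \<Rightarrow>\<^sub>0 'b :: real_vector"
proof -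
  have "finite {i. r *\<^sub>R Poly_Mapping.lookup f i \<noteq> 0}"
    by (rule finite_subset[OF _ finite_keys[of f]]) (auto simp: in_keys_iff)
  then show ?thesis by (simp add: scaleR_poly_mapping_def Abs_poly_mapping_inverse)
qed

lemma lookup_real_point:
  "Poly_Mapping.lookup (real_point n x) i = (if i \<in> {1..n} then real_of_int (x i) else 0)"
  by (simp add: real_point_def lookup_sum lookup_single when_def)

text \<open>By induction on the number of unit transfers separating \<open>y\<close> from \<open>d\<close>: a transfer \<open>z\<close> of
  \<open>y\<close> towards \<open>d\<close> moves two entries apart, so \<open>y\<close> lies on the segment joining \<open>z\<close> to the tuple
  obtained from \<open>z\<close> by swapping these entries.\<close>

lemma dominated_in_convex:
  fixes d y :: "nat \<Rightarrow> int"
  assumes P: "convex P" "\<And>\<sigma>. \<sigma> permutes {1..n} \<Longrightarrow> real_point n (permute \<sigma> d) \<in> P"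
    and d: "antimono_on {1..n} d"
    and "antimono_on {1..n} y" "\<And>k. k \<le> n \<Longrightarrow> sum y {1..k} \<le> sum d {1..k}"
      "sum y {1..n} = sum d {1..n}" "\<sigma> permutes {1..n}"
  shows "real_point n (permute \<sigma> y) \<in> P"
  using assms(4-)
proof (induction "nat (\<Sum>k\<le>n. sum d {1..k} - sum y {1..k})" arbitrary: y \<sigma> rule: less_induct)
  case less
  note le = less.prems(2) and total = less.prems(3)
  have step: "sum f {1..k} = sum f {1..k - 1} + f k" if "1 \<le> k" for f :: "nat \<Rightarrow> int" and k
    using that by (cases k) simp_all
  show ?case
  proof (cases "\<exists>k\<le>n. sum y {1..k} \<noteq> sum d {1..k}")
    case False
    then have eq: "y k = d k" if "k \<in> {1..n}" for k
    proof -
      have "sum y {1..k} = sum d {1..k}" "sum y {1..k - 1} = sum d {1..k - 1}" "1 \<le> k"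
        using False that by auto
      then show ?thesis using step[of k y] step[of k d] by linarith
    qed
    have "inv' \<sigma> i \<in> {1..n}" if "i \<in> {1..n}" for i
      using permutes_in_image[OF permutes_inv[OF less.prems(4)]] that by blast
    then have "real_point n (permute \<sigma> y) = real_point n (permute \<sigma> d)"
      by (intro poly_mapping_eqI) (simp add: lookup_real_point permute_def eq del: atLeastAtMost_iff)
    then show ?thesis using P(2)[OF less.prems(4)] by simp
  next
    case True
    \<comment> \<open>\<open>k\<close> is the first index where the partial sums differ, and
      \<open>r\<close> below is the next one where they agree again. In between the inequality is
      strict, so a unit can move from entry \<open>r\<close> to entry \<open>k\<close> without
      breaking dominance.\<close>
    define k where "k = (LEAST k. k \<le> n \<and> sum y {1..k} \<noteq> sum d {1..k})"
    have k: "k \<le> n" "sum y {1..k} \<noteq> sum d {1..k}"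
      using LeastI_ex[OF True] by (auto simp: k_def)
    have below_k: "sum y {1..j} = sum d {1..j}" if "j < k" for j
      using not_less_Least[OF that[unfolded k_def]] that k by auto
    have k1: "1 \<le> k" using k(2) by (cases k) auto
    have "k \<noteq> n" using k(2) total by auto
    with k have "k < n" by simp
    define r where "r = (LEAST r. k < r \<and> sum y {1..r} = sum d {1..r})"
    have ex: "\<exists>r. k < r \<and> sum y {1..r} = sum d {1..r}"
      using \<open>k < n\<close> total by auto
    have r: "k < r" "sum y {1..r} = sum d {1..r}"
      using LeastI_ex[OF ex] by (auto simp: r_def)
    have "r \<le> n"
      unfolding r_def by (rule Least_le) (use \<open>k < n\<close> total in auto)
    have strict: "sum y {1..j} < sum d {1..j}" if "k \<le> j" "j < r" for j
    proof -
      have "sum y {1..j} \<noteq> sum d {1..j}"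
        using k(2) that not_less_Least[OF that(2)[unfolded r_def]] by (cases "j = k") auto
      then show ?thesis using le[of j] that \<open>r \<le> n\<close> by simp
    qed
    have anti: "f j \<le> f i" if "antimono_on {1..n} f" "1 \<le> i" "i \<le> j" "j \<le> n" for f :: "nat \<Rightarrow> int" and i j
      using that by (auto simp: monotone_on_def)
    note y_anti = anti[OF less.prems(1)]
    have yk: "y k < d k"
      using step[OF k1, of y] step[OF k1, of d] below_k[of "k - 1"] k1 strict[of k] r(1) by linarith
    have yr: "d r < y r"
      using step[of r y] step[of r d] strict[of "r - 1"] r by linarith
    \<comment> \<open>The partial sums agree before \<open>k\<close>, so
      \<open>y k < d k \<le> d (k - 1) \<le> y (k - 1)\<close>: raising entry \<open>k\<close> keeps
      the order. \<open>y_right\<close> is the mirror image at \<open>r\<close>.\<close>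
    have y_left: "y k + 1 \<le> y i" if "1 \<le> i" "i < k" for i
    proof -
      have "d (k - 1) \<le> y (k - 1)"
      proof -
        have "1 \<le> k - 1" "k - 1 - 1 \<le> n" "k - 1 < k" using that k by auto
        then show ?thesis
          using step[of "k - 1" y] step[of "k - 1" d] below_k[of "k - 1"] le[of "k - 1 - 1"]
          by linarith
      qed
      moreover have "d k \<le> d (k - 1)" "y (k - 1) \<le> y i"
        using anti[OF d, of "k - 1" k] y_anti[of i "k - 1"] that k by auto
      ultimately show ?thesis using yk by simp
    qed
    have y_right: "y j \<le> y r - 1" if "r < j" "j \<le> n" for j
    proof -
      have "y (r + 1) \<le> d (r + 1)"
      proof -
        have "1 \<le> r + 1" "r + 1 - 1 = r" "r + 1 \<le> n" using that by auto
        then show ?thesis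
          using step[of "r + 1" y] step[of "r + 1" d] r(2) le[of "r + 1"] by simp
      qed
      moreover have "d (r + 1) \<le> d r" "y j \<le> y (r + 1)"
        using anti[OF d, of r "r + 1"] y_anti[of "r + 1" j] that r by auto
      ultimately show ?thesis using yr by simp
    qed
    define z where "z = y(k := y k + 1, r := y r - 1)"
    have z_eq: "z i = y i + (if i = k then 1 else 0) - (if i = r then 1 else 0)" for i
      using r(1) by (simp add: z_def)
    have z_sum: "sum z {1..m} =
        sum y {1..m} + (if k \<le> m then 1 else 0) - (if r \<le> m then 1 else 0)" for m
      using k1 r(1) by (simp add: z_eq sum.distrib sum_subtractf)
    have z_anti: "antimono_on {1..n} z"
    proof (intro monotone_onI)
      fix i j assume ij: "i \<in> {1..n}" "j \<in> {1..n}" "i \<le> j"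
      then show "z j \<le> z i"
        using y_anti[of i j] y_left[of i] y_right[of j] r(1) by (auto simp: z_eq)
    qed
    have z_le: "sum z {1..m} \<le> sum d {1..m}" if "m \<le> n" for m
      using le[OF that] strict[of m] z_sum[of m] by (cases "k \<le> m"; cases "r \<le> m") simp_all
    have z_total: "sum z {1..n} = sum d {1..n}"
      using total \<open>k < n\<close> \<open>r \<le> n\<close> z_sum[of n] by simp
    have z_ge: "sum y {1..m} \<le> sum z {1..m}" for m
      using z_sum[of m] r(1) by simp
    have z_gt: "sum y {1..k} < sum z {1..k}"
      using z_sum[of k] r(1) by simp
    have "(\<Sum>j\<le>n. sum d {1..j} - sum z {1..j}) < (\<Sum>j\<le>n. sum d {1..j} - sum y {1..j})"
      by (rule sum_strict_mono_ex1) (use k(1) z_ge z_gt in auto)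
    moreover have "0 \<le> (\<Sum>j\<le>n. sum d {1..j} - sum z {1..j})"
      using z_le by (intro sum_nonneg) simp
    ultimately have dec: "nat (\<Sum>j\<le>n. sum d {1..j} - sum z {1..j}) <
        nat (\<Sum>j\<le>n. sum d {1..j} - sum y {1..j})" by linarith
    have IH: "real_point n (permute \<tau> z) \<in> P" if "\<tau> permutes {1..n}" for \<tau>
      by (rule less.hyps[OF dec z_anti z_le z_total that])
    let ?\<tau> = "Transposition.transpose k r"
    have \<tau>: "?\<tau> permutes {1..n}"
      using k1 \<open>k < n\<close> r(1) \<open>r \<le> n\<close> by (intro permutes_swap_id) auto
    \<comment> \<open>Swapping entries \<open>k\<close> and \<open>r\<close> of \<open>z\<close>
      moves them by \<open>z k - z r\<close>. To get back to \<open>y\<close> they must move by 1,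
      which fixes the weight of the swapped tuple.\<close>
    define t where "t = 1 / real_of_int (z k - z r)"
    have pos: "z k - z r \<ge> 2"
      using y_anti[of k r] k1 r(1) \<open>r \<le> n\<close> by (simp add: z_eq)
    have t: "0 \<le> t" "t \<le> 1" "t * real_of_int (z k - z r) = 1"
      using pos by (auto simp: t_def field_simps)
    have comb: "real_of_int (y j) =
        (1 - t) * real_of_int (z j) + t * real_of_int (z (?\<tau> j))" for j
    proof -
      consider "j = k" | "j = r" | "j \<noteq> k" "j \<noteq> r" by blast
      then show ?thesis
      proof cases
        case 1
        then show ?thesis using t(3) r(1) z_eq[of k] by (simp add: algebra_simps)
      next
        case 2
        moreover have "real_of_int (y r) = real_of_int (z r) + 1"
          using z_eq[of r] r(1) by simp
        ultimately show ?thesis using t(3) by (simp add: algebra_simps)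
      next
        case 3
        then show ?thesis by (simp add: z_eq algebra_simps)
      qed
    qed
    have "permute (\<sigma> \<circ> ?\<tau>) z i = z (?\<tau> (inv' \<sigma> i))" for i
      unfolding permute_comp[OF less.prems(4) \<tau>] by (simp add: permute_def)
    then have "real_point n (permute \<sigma> y) =
        (1 - t) *\<^sub>R real_point n (permute \<sigma> z) + t *\<^sub>R real_point n (permute (\<sigma> \<circ> ?\<tau>) z)"
      by (intro poly_mapping_eqI)
        (simp add: lookup_add lookup_scaleR_poly_mapping lookup_real_point comb permute_def)
    then show ?thesis
      using convexD_alt[OF P(1) IH[OF less.prems(4)] IH[OF permutes_compose[OF \<tau> less.prems(4)]] t(1,2)]
      by simp
  qed
qed

text \<open>For the complete graph, these are the break divisors of An, Baker, Kuperberg and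
  Shokrieh: the bound \<open>(k - 1) (k - 2) / 2\<close> is the genus of the complete graph on \<open>k\<close> vertices.\<close>

definition break_divisors :: "nat \<Rightarrow> (nat \<Rightarrow> int) set" where
  "break_divisors n = {x \<in> {1..n} \<rightarrow>\<^sub>E UNIV. 2 * sum x {1..n} = (int n - 1) * (int n - 2) \<and>
     (\<forall>A\<subseteq>{1..n}. A \<noteq> {} \<longrightarrow> (int (card A) - 1) * (int (card A) - 2) \<le> 2 * sum x A)}"

section \<open>Break divisors under permutation, and the inequalities at the vertices\<close>

lemma sum_permute:
  fixes x :: "nat \<Rightarrow> 'a :: comm_monoid_add"
  assumes "\<sigma> permutes S"
  shows "sum (permute \<sigma> x) A = sum x (inv' \<sigma> ` A)"
  using permutes_inj_on[OF permutes_inv[OF assms]] by (simp add: permute_def sum.reindex)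

lemma permutes_image_subset:
  assumes "\<sigma> permutes S" "A \<subseteq> S"
  shows "\<sigma> ` A \<subseteq> S" "card (\<sigma> ` A) = card A"
  using assms permutes_image[OF assms(1)] card_image[OF permutes_inj_on[OF assms(1)]] by auto

lemma permute_in_break_divisors:
  assumes \<sigma>: "\<sigma> permutes {1..n}" and x: "x \<in> break_divisors n"
  shows "permute \<sigma> x \<in> break_divisors n"
proof -
  have \<sigma>': "inv' \<sigma> permutes {1..n}" using \<sigma> by (rule permutes_inv)
  have "(int (card A) - 1) * (int (card A) - 2) \<le> 2 * sum (permute \<sigma> x) A"
    if "A \<subseteq> {1..n}" "A \<noteq> {}" for A
  proof -
    have "inv' \<sigma> ` A \<subseteq> {1..n}" "inv' \<sigma> ` A \<noteq> {}" "card (inv' \<sigma> ` A) = card A"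
      using permutes_image_subset[OF \<sigma>' that(1)] that(2) by auto
    moreover have "\<forall>A\<subseteq>{1..n}. A \<noteq> {} \<longrightarrow>
        (int (card A) - 1) * (int (card A) - 2) \<le> 2 * sum x A"
      using x by (simp add: break_divisors_def)
    ultimately show ?thesis unfolding sum_permute[OF \<sigma>] by metis
  qed
  then show ?thesis
    using x permute_PiE[OF \<sigma>, of x UNIV] sum_permute[OF \<sigma>, of x "{1..n}"] permutes_image[OF \<sigma>']
    by (simp add: break_divisors_def)
qed

text \<open>An arithmetic progression, except that truncated subtraction makes the last entry 0
  instead of -1; hence the separate case \<open>k = n\<close>.\<close>

lemma sum_delta_prefix:
  assumes "k \<le> n" "2 \<le> n"
  shows "2 * sum (delta n) {1..k} =
    (if k = n then (int n - 1) * (int n - 2) else int k * (2 * int n - 3 - int k))"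
  using assms(1)
proof (induction k)
  case 0
  then show ?case using assms(2) by simp
next
  case (Suc k)
  have "2 * sum (delta n) {1..Suc k} = 2 * sum (delta n) {1..k} + 2 * int (n - 1 - Suc k)"
    using Suc.prems by (simp add: delta_def)
  also have "\<dots> = int k * (2 * int n - 3 - int k) + 2 * int (n - 1 - Suc k)"
    using Suc by simp
  also have "\<dots> = (if Suc k = n then (int n - 1) * (int n - 2)
      else int (Suc k) * (2 * int n - 3 - int (Suc k)))"
    using Suc.prems by (auto simp: algebra_simps of_nat_diff)
  finally show ?case .
qed

text \<open>Remove the least index \<open>j\<close>. Since \<open>A\<close> lies in
  \<open>{j..n}\<close>, the entry at \<open>j\<close> is at least \<open>card A - 2\<close>, which
  covers the growth of the bound.\<close>

lemma sum_delta_lower: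
  assumes "A \<subseteq> {1..n}" "A \<noteq> {}"
  shows "(int (card A) - 1) * (int (card A) - 2) \<le> 2 * sum (delta n) A"
  using assms
proof (induction "card A" arbitrary: A)
  case 0
  then show ?case using finite_subset[OF 0(2)] by simp
next
  case (Suc k)
  have fin: "finite A" using Suc.prems(1) by (rule finite_subset) simp
  let ?j = "Min A"
  have "?j \<in> A" using fin Suc.prems(2) by simp
  then have j: "?j \<in> A" "?j \<in> {1..n}" using Suc.prems(1) by blast+
  have "A \<subseteq> {?j..n}" using Min_le[OF fin] Suc.prems(1) by (metis atLeastAtMost_iff subset_iff)
  then have "card A \<le> n + 1 - ?j" using card_mono[of "{?j..n}" A] by simp
  then have dj: "int k - 1 \<le> delta n ?j" "0 \<le> delta n ?j"
    using Suc.hyps(2) j(2) by (auto simp: delta_def)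
  have card: "card (A - {?j}) = k" using Suc.hyps(2) j(1) fin by simp
  have sum: "sum (delta n) A = delta n ?j + sum (delta n) (A - {?j})"
    using fin j(1) by (rule sum.remove)
  show ?case
  proof (cases "A - {?j} = {}")
    case True
    then have "k = 0" using card[unfolded True] by simp
    then show ?thesis using Suc.hyps(2)[symmetric] sum True dj by simp
  next
    case False
    then have "(int k - 1) * (int k - 2) \<le> 2 * sum (delta n) (A - {?j})"
      using Suc.hyps(1)[of "A - {?j}"] Suc.prems card by auto
    then show ?thesis using sum dj(1) Suc.hyps(2)[symmetric] by (simp add: algebra_simps)
  qed
qed

lemma antimono_delta: "antimono_on {1..n} (delta n)"
  by (auto simp: monotone_on_def delta_def)

lemma delta_in_break_divisors: "2 \<le> n \<Longrightarrow> delta n \<in> break_divisors n"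
  using sum_delta_lower[of _ n] sum_delta_prefix[of n n] by (simp add: break_divisors_def delta_def)

text \<open>The factor \<open>s\<close> serves lower bounds (\<open>s = 2\<close>) and, with
  \<open>s = -2\<close>, the upper bound on the total.\<close>

lemma convex_sum_lookup_ge:
  "convex {f :: nat \<Rightarrow>\<^sub>0 real. c \<le> s * (\<Sum>i\<in>A. Poly_Mapping.lookup f i)}"
proof (rule convexI, unfold mem_Collect_eq)
  fix f g :: "nat \<Rightarrow>\<^sub>0 real" and u v :: real
  let ?L = "\<lambda>f. s * (\<Sum>i\<in>A. Poly_Mapping.lookup f i)"
  assume "c \<le> ?L f" "c \<le> ?L g" and uv: "0 \<le> u" "0 \<le> v" "u + v = 1"
  then have "u * c + v * c \<le> u * ?L f + v * ?L g"
    by (intro add_mono mult_left_mono)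
  also have "u * c + v * c = c"
    using uv(3) by (simp flip: distrib_right)
  also have "u * ?L f + v * ?L g = ?L (u *\<^sub>R f + v *\<^sub>R g)"
    by (simp add: lookup_add lookup_scaleR_poly_mapping sum.distrib sum_distrib_left algebra_simps)
  finally show "c \<le> ?L (u *\<^sub>R f + v *\<^sub>R g)" .
qed

lemma sum_lookup_real_point:
  assumes "A \<subseteq> {1..n}"
  shows "(\<Sum>i\<in>A. Poly_Mapping.lookup (real_point n x) i) = real_of_int (sum x A)"
  using assms by (auto simp: lookup_real_point intro!: sum.cong)

text \<open>A linear inequality valid at the generating points holds on their convex hull.\<close>

lemma lattice_points_sum_ge:
  assumes "x \<in> lattice_points n" "A \<subseteq> {1..n}"
    and "\<And>\<sigma>. \<sigma> permutes {1..n} \<Longrightarrow> c \<le> s * sum (permute \<sigma> (delta n)) A"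
  shows "c \<le> s * sum x A"
proof -
  let ?H = "{f :: nat \<Rightarrow>\<^sub>0 real. real_of_int c \<le> real_of_int s * (\<Sum>i\<in>A. Poly_Mapping.lookup f i)}"
  have "real_of_int c \<le> real_of_int s * real_of_int (sum (permute \<sigma> (delta n)) A)"
    if "\<sigma> permutes {1..n}" for \<sigma>
    using assms(3)[OF that] by (simp only: of_int_mult[symmetric] of_int_le_iff)
  then have "real_point n (permute \<sigma> (delta n)) \<in> ?H" if "\<sigma> permutes {1..n}" for \<sigma>
    using that sum_lookup_real_point[OF assms(2)] by (simp del: of_int_sum)
  then have "P_delta n \<subseteq> ?H"
    unfolding P_delta_def using convex_sum_lookup_ge
    by (intro hull_minimal) (auto simp: sym_group_carrier)
  then have "real_of_int c \<le> real_of_int s * real_of_int (sum x A)"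
    using assms(1) sum_lookup_real_point[OF assms(2), of x] by (auto simp: lattice_points_def)
  then show ?thesis by (simp only: of_int_mult[symmetric] of_int_le_iff)
qed

text \<open>Rado's theorem for \<open>delta n\<close>: the inequalities pass from the vertices to
  the hull, and conversely they say that the sorted tuple is dominated by
  \<open>delta n\<close>.\<close>

theorem lattice_points_eq_break_divisors:
  assumes n: "2 \<le> n"
  shows "lattice_points n = break_divisors n"
proof (intro equalityI subsetI)
  fix x assume x: "x \<in> lattice_points n"
  have perm: "permute \<sigma> (delta n) \<in> break_divisors n" if "\<sigma> permutes {1..n}" for \<sigma>
    using permute_in_break_divisors[OF that delta_in_break_divisors[OF n]] .
  have lower: "(int (card A) - 1) * (int (card A) - 2) \<le> 2 * sum x A"
    if "A \<subseteq> {1..n}" "A \<noteq> {}" for A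
    by (rule lattice_points_sum_ge[OF x that(1)]) (use perm that in \<open>auto simp: break_divisors_def\<close>)
  have "(int n - 1) * (int n - 2) \<le> 2 * sum x {1..n}"
    by (rule lattice_points_sum_ge[OF x order_refl]) (use perm in \<open>auto simp: break_divisors_def\<close>)
  moreover have "- ((int n - 1) * (int n - 2)) \<le> - 2 * sum x {1..n}"
    by (rule lattice_points_sum_ge[OF x order_refl]) (use perm in \<open>auto simp: break_divisors_def\<close>)
  ultimately show "x \<in> break_divisors n"
    using lower x by (auto simp: break_divisors_def lattice_points_def)
next
  fix x assume x: "x \<in> break_divisors n"
  obtain \<sigma> where \<sigma>: "\<sigma> permutes {1..n}" and anti: "antimono_on {1..n} (permute \<sigma> x)"
    using ex_sorting_permutation[of n x] by auto
  define y where "y = permute \<sigma> x"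
  have y: "y \<in> break_divisors n"
    unfolding y_def using permute_in_break_divisors[OF \<sigma> x] .
  have total: "sum y {1..n} = sum (delta n) {1..n}"
    using y sum_delta_prefix[of n n] n by (simp add: break_divisors_def)
  have prefix: "sum y {1..k} \<le> sum (delta n) {1..k}" if "k \<le> n" for k
  proof (cases "k = n")
    case False
    \<comment> \<open>With the total fixed, the lower bound on the tail is an upper bound on the
      prefix.\<close>
    then have "{k<..n} \<noteq> {}" "{k<..n} \<subseteq> {1..n}" using that by auto
    then have "(int (card {k<..n}) - 1) * (int (card {k<..n}) - 2) \<le> 2 * sum y {k<..n}"
      using y unfolding break_divisors_def by blast
    moreover have "sum y {1..n} = sum y {1..k} + sum y {k<..n}"
      using that by (subst sum.union_disjoint[symmetric]) (auto intro!: sum.cong)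
    moreover have "2 * sum y {1..n} = (int n - 1) * (int n - 2)"
      using y by (simp add: break_divisors_def)
    ultimately have "2 * sum y {1..k} \<le> int k * (2 * int n - 3 - int k)"
      using that by (simp add: of_nat_diff algebra_simps)
    then show ?thesis using sum_delta_prefix[OF that n] False by simp
  qed (use total in simp)
  have "real_point n (permute (inv' \<sigma>) y) \<in> P_delta n"
  proof (rule dominated_in_convex[OF _ _ antimono_delta anti[folded y_def] prefix total])
    show "convex (P_delta n)" by (simp add: P_delta_def convex_convex_hull)
    show "real_point n (permute \<tau> (delta n)) \<in> P_delta n" if "\<tau> permutes {1..n}" for \<tau>
      unfolding P_delta_def using that by (intro hull_inc) (auto simp: sym_group_carrier)
    show "inv' \<sigma> permutes {1..n}" using \<sigma> by (rule permutes_inv)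
  qed
  then show "x \<in> lattice_points n"
    using x permute_inverse(2)[OF \<sigma>, of x] by (simp add: y_def lattice_points_def break_divisors_def)
qed

subsection \<open>Shift classes and lattice points\<close>

lemma int_c_num:
  assumes "2 \<le> n"
  shows "2 * int (c_num n) = (int n - 1) * (int n - 2)"
proof -
  have "even ((n - 2) * (n - 1))" by auto
  then have "2 * c_num n = (n - 2) * (n - 1)" by (simp add: c_num_def)
  then have "2 * int (c_num n) = int (n - 2) * int (n - 1)" by (metis of_nat_mult of_nat_numeral)
  then show ?thesis using assms by (simp add: of_nat_diff mult.commute)
qed

lemma C_set_iff:
  assumes "2 \<le> n"
  shows "x \<in> C_set n \<longleftrightarrow> x \<in> {1..n} \<rightarrow>\<^sub>E {0..n-1} \<and>
    [(\<Sum>i\<in>{1..n}. int (x i)) = int (c_num n)] (mod int n)"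
  by (simp add: C_set_def cong_def of_nat_mod[symmetric] flip: of_nat_sum)

lemma C_set_less: "x \<in> C_set n \<Longrightarrow> i \<in> {1..n} \<Longrightarrow> x i < n"
  by (auto simp: C_set_def PiE_def Pi_def)

lemma shift_funpow:
  assumes "x \<in> C_set n" "i \<in> {1..n}"
  shows "(shift n ^^ j) x i = (x i + j) mod n"
proof (induction j)
  case 0
  then show ?case using C_set_less[OF assms] by simp
next
  case (Suc j)
  then show ?case using assms(2) by (simp add: shift_def mod_Suc_eq)
qed

lemma shift_funpow_extensional:
  assumes "x \<in> C_set n" "i \<notin> {1..n}"
  shows "(shift n ^^ j) x i = undefined"
proof (cases j)
  case 0
  then show ?thesis using assms by (auto simp: C_set_def)
qed (use assms(2) in \<open>auto simp: shift_def\<close>)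

text \<open>Reducing \<open>a\<close> modulo \<open>n\<close> gives a number of shifts. Integer
  translations are convenient because they can be negated.\<close>

lemma shift_rel_iff:
  assumes "2 \<le> n"
  shows "(x, y) \<in> shift_rel n \<longleftrightarrow> x \<in> C_set n \<and> y \<in> C_set n \<and>
    (\<exists>a. \<forall>i\<in>{1..n}. [int (y i) = int (x i) + a] (mod int n))"
proof -
  have "(\<exists>j. y = (shift n ^^ j) x) \<longleftrightarrow> (\<exists>a. \<forall>i\<in>{1..n}. [int (y i) = int (x i) + a] (mod int n))"
    if x: "x \<in> C_set n" and y: "y \<in> C_set n"
  proof
    assume "\<exists>j. y = (shift n ^^ j) x"
    then obtain j where "y = (shift n ^^ j) x" by blast
    then have "[int (y i) = int (x i) + int j] (mod int n)" if "i \<in> {1..n}" for i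
      using shift_funpow[OF x that, of j] by (simp add: cong_def of_nat_mod)
    then show "\<exists>a. \<forall>i\<in>{1..n}. [int (y i) = int (x i) + a] (mod int n)" by blast
  next
    assume "\<exists>a. \<forall>i\<in>{1..n}. [int (y i) = int (x i) + a] (mod int n)"
    then obtain a where a: "[int (y i) = int (x i) + a] (mod int n)" if "i \<in> {1..n}" for i by blast
    define j where "j = nat (a mod int n)"
    have j: "int j = a mod int n" using assms by (simp add: j_def)
    have "y i = (shift n ^^ j) x i" for i
    proof (cases "i \<in> {1..n}")
      case True
      have "int (y i) = int (y i) mod int n"
        using C_set_less[OF y True] by simp
      also have "\<dots> = (int (x i) + int j) mod int n"
        using a[OF True] by (simp add: cong_def j mod_add_right_eq)
      also have "\<dots> = int ((shift n ^^ j) x i)"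
        by (simp add: shift_funpow[OF x True] of_nat_mod)
      finally show ?thesis by simp
    next
      case False
      then show ?thesis using shift_funpow_extensional[OF x False] y by (auto simp: C_set_def)
    qed
    then show "\<exists>j. y = (shift n ^^ j) x" by blast
  qed
  then show ?thesis by (auto simp: shift_rel_def)
qed

lemma equiv_shift_rel:
  assumes "2 \<le> n"
  shows "equiv (C_set n) (shift_rel n)"
proof (rule equivI)
  show "shift_rel n \<subseteq> C_set n \<times> C_set n" by (auto simp: shift_rel_def)
  show "refl_on (C_set n) (shift_rel n)"
    by (auto simp: refl_on_def shift_rel_iff[OF assms] intro: exI[of _ 0])
  show "sym (shift_rel n)"
  proof (rule symI, unfold shift_rel_iff[OF assms], elim conjE exE, intro conjI exI ballI)
    fix x y a i assume "\<forall>i\<in>{1..n}. [int (y i) = int (x i) + a] (mod int n)" "i \<in> {1..n}"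
    then have "[int (y i) = int (x i) + a] (mod int n)" by blast
    then have "[int (y i) + - a = int (x i) + a + - a] (mod int n)"
      by (rule cong_add[OF _ cong_refl])
    then show "[int (x i) = int (y i) + - a] (mod int n)" by (simp add: cong_sym)
  qed
  show "trans (shift_rel n)"
  proof (rule transI, unfold shift_rel_iff[OF assms], elim conjE exE, intro conjI exI ballI)
    fix x y z a b i
    assume "\<forall>i\<in>{1..n}. [int (y i) = int (x i) + a] (mod int n)"
      "\<forall>i\<in>{1..n}. [int (z i) = int (y i) + b] (mod int n)" "i \<in> {1..n}"
    then have "[int (y i) + b = int (x i) + a + b] (mod int n)" "[int (z i) = int (y i) + b] (mod int n)"
      by (auto intro: cong_add[OF _ cong_refl])
    then show "[int (z i) = int (x i) + (a + b)] (mod int n)"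
      by (metis add.assoc cong_trans)
  qed
qed

text \<open>Defined on all integer tuples, so that one map serves the lattice points and the
  completed parking functions, whose last entry may exceed \<open>n - 1\<close>.\<close>

definition shift_class :: "nat \<Rightarrow> (nat \<Rightarrow> int) \<Rightarrow> (nat \<Rightarrow> nat) set" where
  "shift_class n x = shift_rel n `` {\<lambda>i\<in>{1..n}. nat (x i mod int n)}"

lemma residue_in_C_set:
  assumes n: "2 \<le> n" and "[sum x {1..n} = int (c_num n)] (mod int n)"
  shows "(\<lambda>i\<in>{1..n}. nat (x i mod int n)) \<in> C_set n"
proof -
  have "nat (x i mod int n) \<le> n - 1" for i
    using n pos_mod_bound[of "int n" "x i"] by linarith
  moreover have "(\<Sum>i\<in>{1..n}. int ((\<lambda>i\<in>{1..n}. nat (x i mod int n)) i)) = (\<Sum>i\<in>{1..n}. x i mod int n)"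
    using n by (intro sum.cong) auto
  moreover have "[(\<Sum>i\<in>{1..n}. x i mod int n) = sum x {1..n}] (mod int n)"
    by (rule cong_sum) (simp add: cong_def)
  ultimately show ?thesis
    using assms(2) unfolding C_set_iff[OF n] by (auto intro: cong_trans)
qed

lemma shift_class_eq_iff:
  assumes n: "2 \<le> n" and "[sum x {1..n} = int (c_num n)] (mod int n)"
    "[sum y {1..n} = int (c_num n)] (mod int n)"
  shows "shift_class n x = shift_class n y \<longleftrightarrow>
    (\<exists>a. \<forall>i\<in>{1..n}. [y i = x i + a] (mod int n))"
proof -
  let ?r = "\<lambda>x. \<lambda>i\<in>{1..n}. nat (x i mod int n)"
  have C: "?r x \<in> C_set n" "?r y \<in> C_set n"
    by (rule residue_in_C_set[OF n assms(2)], rule residue_in_C_set[OF n assms(3)])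
  have "shift_class n x = shift_class n y \<longleftrightarrow> (?r x, ?r y) \<in> shift_rel n"
    unfolding shift_class_def by (rule eq_equiv_class_iff[OF equiv_shift_rel[OF n] C])
  also have "\<dots> \<longleftrightarrow> (\<exists>a. \<forall>i\<in>{1..n}. [y i = x i + a] (mod int n))"
    using n C by (simp add: shift_rel_iff cong_def mod_simps)
  finally show ?thesis .
qed

lemma shift_class_int:
  assumes "2 \<le> n" "u \<in> C_set n"
  shows "shift_class n (\<lambda>i. int (u i)) = shift_rel n `` {u}"
proof -
  have "(\<lambda>i\<in>{1..n}. nat (int (u i) mod int n)) = u"
    using assms C_set_less[OF assms(2)]
    by (intro PiE_ext[where k = "{1..n}" and s = "\<lambda>_. UNIV"])
      (auto simp: C_set_def nat_mod_as_int[symmetric] PiE_iff)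
  then show ?thesis by (simp add: shift_class_def)
qed

lemma shift_class_in_C_hat:
  assumes "2 \<le> n" "[sum x {1..n} = int (c_num n)] (mod int n)"
  shows "shift_class n x \<in> C_hat n"
  unfolding shift_class_def C_hat_def by (rule quotientI[OF residue_in_C_set[OF assms]])

lemma C_hatE:
  assumes "2 \<le> n" "c \<in> C_hat n"
  obtains x where "[sum x {1..n} = int (c_num n)] (mod int n)" "c = shift_class n x"
proof -
  obtain u where u: "u \<in> C_set n" "c = shift_rel n `` {u}"
    using assms(2) unfolding C_hat_def by (rule quotientE)
  then show ?thesis
    using that[of "\<lambda>i. int (u i)"] shift_class_int[OF assms(1) u(1)] C_set_iff[OF assms(1)] by auto
qed

section \<open>Permutations acting on shift classes\<close>

lemma permute_in_C_set:
  assumes \<sigma>: "\<sigma> permutes {1..n}" and x: "x \<in> C_set n"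
  shows "permute \<sigma> x \<in> C_set n"
  using x permute_PiE[OF \<sigma>, of x "{0..n-1}"] sum_permute[OF \<sigma>, of x "{1..n}"]
    permutes_image[OF permutes_inv[OF \<sigma>]]
  by (simp add: C_set_def)

lemma permute_shift_rel:
  assumes n: "2 \<le> n" and \<sigma>: "\<sigma> permutes {1..n}" and xy: "(x, y) \<in> shift_rel n"
  shows "(permute \<sigma> x, permute \<sigma> y) \<in> shift_rel n"
proof -
  have "inv' \<sigma> i \<in> {1..n}" if "i \<in> {1..n}" for i
    using permutes_in_image[OF permutes_inv[OF \<sigma>]] that by blast
  then show ?thesis
    using xy permute_in_C_set[OF \<sigma>] unfolding shift_rel_iff[OF n] permute_def comp_def by blast
qed

lemma permute_shift_class:
  assumes n: "2 \<le> n" and \<sigma>: "\<sigma> permutes {1..n}"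
  shows "shift_class n (permute \<sigma> x) = permute \<sigma> ` shift_class n x"
proof -
  let ?r = "\<lambda>x. \<lambda>i\<in>{1..n}. nat (x i mod int n)"
  have \<sigma>': "inv' \<sigma> permutes {1..n}" using \<sigma> by (rule permutes_inv)
  have r: "?r (permute \<sigma> x) = permute \<sigma> (?r x)"
  proof
    fix i
    show "?r (permute \<sigma> x) i = permute \<sigma> (?r x) i"
      using permutes_in_image[OF \<sigma>', of i] by (simp add: permute_def restrict_def)
  qed
  have "shift_rel n `` {permute \<sigma> u} = permute \<sigma> ` (shift_rel n `` {u})" for u
  proof (intro equalityI subsetI)
    fix v assume "v \<in> shift_rel n `` {permute \<sigma> u}"
    then have "(permute (inv' \<sigma>) (permute \<sigma> u), permute (inv' \<sigma>) v) \<in> shift_rel n"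
      using permute_shift_rel[OF n \<sigma>'] by blast
    then have "permute (inv' \<sigma>) v \<in> shift_rel n `` {u}"
      by (simp add: permute_inverse[OF \<sigma>])
    then show "v \<in> permute \<sigma> ` (shift_rel n `` {u})"
      using permute_inverse(1)[OF \<sigma>, of v] by (metis imageI)
  next
    fix v assume "v \<in> permute \<sigma> ` (shift_rel n `` {u})"
    then show "v \<in> shift_rel n `` {permute \<sigma> u}"
      using permute_shift_rel[OF n \<sigma>] by blast
  qed
  then show ?thesis unfolding shift_class_def r .
qed

lemma sum_permute_carrier:
  fixes x :: "nat \<Rightarrow> 'a :: comm_monoid_add"
  assumes "\<sigma> permutes S"
  shows "sum (permute \<sigma> x) S = sum x S"
  using sum_permute[OF assms, of x S] permutes_image[OF permutes_inv[OF assms]] by simp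

lemma action_on_C_hat:
  assumes n: "2 \<le> n"
  shows "action_on (sym_group n) (C_hat n) (\<lambda>\<sigma> c. permute \<sigma> ` c)"
  unfolding action_on_def sym_group_carrier sym_group_mult sym_group_one
proof (intro conjI ballI)
  show "permute \<sigma> ` c \<in> C_hat n" if g: "\<sigma> \<in> carrier (sym_group n)" and c: "c \<in> C_hat n" for \<sigma> c
  proof -
    have \<sigma>: "\<sigma> permutes {1..n}" using g by (simp add: sym_group_carrier)
    obtain x where x: "[sum x {1..n} = int (c_num n)] (mod int n)" "c = shift_class n x"
      using C_hatE[OF n c] .
    then show ?thesis
      using shift_class_in_C_hat[OF n, of "permute \<sigma> x"] permute_shift_class[OF n \<sigma>, of x]
        sum_permute_carrier[OF \<sigma>, of x] by simp
  qed
  show "permute (\<sigma> \<circ> \<tau>) ` c = permute \<sigma> ` permute \<tau> ` c"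
    if "\<sigma> \<in> carrier (sym_group n)" "\<tau> \<in> carrier (sym_group n)" for \<sigma> \<tau> and c :: "(nat \<Rightarrow> nat) set"
    using that by (simp add: sym_group_carrier permute_comp[of _ "{1..n}"] image_image)
qed (simp_all add: sym_group_is_group)

text \<open>Two congruent points differ by the Laplacian of an integer function \<open>w\<close> on the complete
  graph; comparing them on the set where \<open>w\<close> is minimal violates the lower bound for one of them.\<close>

lemma break_divisors_unique:
  assumes n: "2 \<le> n" and x: "x \<in> break_divisors n" and y: "y \<in> break_divisors n"
    and cong: "\<forall>i\<in>{1..n}. [y i = x i + a] (mod int n)"
  shows "x = y"
proof -
  have "\<exists>w. \<forall>i\<in>{1..n}. y i = x i + a + int n * w i"
    using cong by (intro bchoice) (metis cong_iff_lin cong_sym)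
  then obtain w where w: "y i = x i + a + int n * w i" if "i \<in> {1..n}" for i by blast
  have sum_y: "sum y A = sum x A + int (card A) * a + int n * sum w A" if "A \<subseteq> {1..n}" for A
  proof -
    have "sum y A = (\<Sum>i\<in>A. x i + a + int n * w i)"
      using that w by (intro sum.cong) auto
    then show ?thesis by (simp add: sum.distrib sum_distrib_left)
  qed
  have tot: "2 * sum x {1..n} = (int n - 1) * (int n - 2)" "2 * sum y {1..n} = (int n - 1) * (int n - 2)"
    using x y by (auto simp: break_divisors_def)
  then have "int n * (a + sum w {1..n}) = 0"
    using sum_y[OF order_refl] by (simp add: algebra_simps)
  \<comment> \<open>Now \<open>y i - x i = n * w i - sum w {1..n}\<close>, the Laplacian of the
    complete graph applied to \<open>w\<close>.\<close>
  then have a: "a = - sum w {1..n}" using n by simp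
  define \<mu> where "\<mu> = Min (w ` {1..n})"
  have ne: "w ` {1..n} \<noteq> {}" using n by simp
  have \<mu>: "\<mu> \<le> w i" if "i \<in> {1..n}" for i using that by (simp add: \<mu>_def)
  define A where "A = {i \<in> {1..n}. w i = \<mu>}"
  have A: "A \<subseteq> {1..n}" "finite A" by (auto simp: A_def)
  have "\<mu> \<in> w ` {1..n}" unfolding \<mu>_def using ne by (intro Min_in) auto
  then have "A \<noteq> {}" by (auto simp: A_def)
  let ?B = "{1..n} - A"
  let ?k = "int (card A)" and ?m = "int (card ?B)"
  have km: "int n = ?k + ?m"
    using card_Diff_subset[OF A(2,1)] card_mono[OF _ A(1)] by simp
  have sum_split: "sum f {1..n} = sum f A + sum f ?B" for f :: "nat \<Rightarrow> int"
    using sum.subset_diff[OF A(1)] by (simp add: add.commute)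
  have wA: "sum w A = ?k * \<mu>" by (simp add: A_def)
  show "x = y"
  proof (cases "?B = {}")
    case True
    then have "w i = \<mu>" if "i \<in> {1..n}" for i using that by (auto simp: A_def)
    moreover have "sum w ?B = 0" "?m = 0" unfolding True by simp_all
    then have "sum w {1..n} = int n * \<mu>" using sum_split[of w] wA km by simp
    ultimately have "x i = y i" if "i \<in> {1..n}" for i
      using w[OF that] a that by (simp del: atLeastAtMost_iff)
    then show ?thesis
      using x y by (intro PiE_ext[of x "{1..n}" "\<lambda>_. UNIV" y]) (auto simp: break_divisors_def)
  next
    case False
    \<comment> \<open>Outside \<open>A\<close> the integer \<open>w i\<close> exceeds the minimum by
      at least 1.\<close>
    have "?m * (\<mu> + 1) \<le> sum w ?B"
    proof (rule sum_bounded_below)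
      fix i assume "i \<in> ?B"
      then show "\<mu> + 1 \<le> w i" using \<mu>[of i] by (auto simp: A_def)
    qed
    then have "a \<le> - (int n * \<mu> + ?m)"
      using a sum_split[of w] wA km by (simp add: algebra_simps)
    then have "?k * a \<le> ?k * - (int n * \<mu> + ?m)" by (rule mult_left_mono) simp
    then have "sum y A \<le> sum x A - ?k * ?m"
      using sum_y[OF A(1)] wA by (simp add: algebra_simps)
    moreover have "(?k - 1) * (?k - 2) \<le> 2 * sum y A"
      using y A(1) \<open>A \<noteq> {}\<close> by (simp add: break_divisors_def)
    moreover have "(?m - 1) * (?m - 2) \<le> 2 * sum x ?B"
      using x False unfolding break_divisors_def by blast
    moreover have "2 * (sum x A + sum x ?B) = (?k + ?m - 1) * (?k + ?m - 2)"
      using tot(1) sum_split[of x] km by simp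
    \<comment> \<open>The facts collected give \<open>2 * sum y A \<le> ?k * (?k - 3)\<close>, which
      is 2 below the lower bound \<open>(?k - 1) * (?k - 2)\<close>.\<close>
    ultimately have False by (simp add: algebra_simps)
    then show ?thesis ..
  qed
qed

text \<open>A representative of least Euclidean norm is a break divisor: adding the Laplacian of the
  indicator function of \<open>A\<close> does not decrease the norm, which bounds the sum over \<open>A\<close> from
  below.\<close>

lemma break_divisors_exists:
  assumes n: "2 \<le> n" and u: "[sum u {1..n} = int (c_num n)] (mod int n)"
  obtains y a where "y \<in> break_divisors n" "\<forall>i\<in>{1..n}. [y i = u i + a] (mod int n)"
proof -
  let ?N = "\<lambda>y. \<Sum>i\<in>{1..n}. y i * y i :: int"
  define R where "R = {y \<in> {1..n} \<rightarrow>\<^sub>E UNIV. sum y {1..n} = int (c_num n) \<and>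
    (\<exists>a. \<forall>i\<in>{1..n}. [y i = u i + a] (mod int n))}"
  have "\<exists>y. y \<in> R"
  proof
    \<comment> \<open>The total of \<open>u\<close> is off by a multiple of \<open>n\<close>, which
      one coordinate can absorb without changing residues.\<close>
    let ?y = "\<lambda>i\<in>{1..n}. u i + (if i = 1 then int (c_num n) - sum u {1..n} else 0)"
    have "sum ?y {1..n} = sum u {1..n} + (\<Sum>i\<in>{1..n}. if i = 1 then int (c_num n) - sum u {1..n} else 0)"
      unfolding sum.distrib[symmetric] by (intro sum.cong) auto
    also have "\<dots> = int (c_num n)" using n by simp
    finally have "sum ?y {1..n} = int (c_num n)" .
    moreover have "[?y i = u i + 0] (mod int n)" if "i \<in> {1..n}" for i
      using that u by (auto simp: cong_iff_dvd_diff dvd_diff_commute)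
    moreover have "?y \<in> {1..n} \<rightarrow>\<^sub>E UNIV" by simp
    ultimately show "?y \<in> R"
      unfolding R_def mem_Collect_eq by (intro conjI exI[of _ 0] ballI)
  qed
  then obtain y0 where "y0 \<in> R" ..
  from ex_has_least_nat[of "\<lambda>y. y \<in> R", OF this, of "\<lambda>y. nat (?N y)"]
  obtain y where y: "y \<in> R" and min: "\<forall>z. z \<in> R \<longrightarrow> nat (?N y) \<le> nat (?N z)"
    by blast
  have tot: "2 * sum y {1..n} = (int n - 1) * (int n - 2)"
    using y int_c_num[OF n] by (simp add: R_def)
  have "(int (card A) - 1) * (int (card A) - 2) \<le> 2 * sum y A" if A: "A \<subseteq> {1..n}" "A \<noteq> {}" for A
  proof -
    let ?k = "int (card A)"
    have finA: "finite A" using A(1) by (rule finite_subset) simp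
    have k: "1 \<le> ?k" "?k \<le> int n"
      using A finA card_mono[OF _ A(1)] card_gt_0_iff[of A] by auto
    let ?e = "\<lambda>i. (if i \<in> A then int n else 0)"
    \<comment> \<open>Adding the Laplacian of the indicator of \<open>A\<close> keeps the total, and
      shifts all residues by the same amount \<open>- ?k\<close>.\<close>
    define z where "z = (\<lambda>i\<in>{1..n}. y i + ?e i - ?k)"
    have sum_e: "(\<Sum>i\<in>{1..n}. if i \<in> A then f i else 0) = sum f A" for f :: "nat \<Rightarrow> int"
      using A(1) by (simp add: sum.If_cases Int_absorb1)
    have "sum z {1..n} = (\<Sum>i\<in>{1..n}. y i + ?e i - ?k)"
      by (simp add: z_def)
    also have "\<dots> = sum y {1..n}"
      using sum_e[of "\<lambda>_. int n"] by (simp add: sum.distrib sum_subtractf)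
    finally have z_sum: "sum z {1..n} = int (c_num n)" using y by (simp add: R_def)
    obtain a where a: "\<forall>i\<in>{1..n}. [y i = u i + a] (mod int n)"
      using y unfolding R_def by blast
    have "[z i = u i + (a - ?k)] (mod int n)" if "i \<in> {1..n}" for i
    proof -
      have "[y i + (?e i - ?k) = u i + a + (- ?k)] (mod int n)"
        by (intro cong_add bspec[OF a that]) (simp add: cong_iff_dvd_diff)
      then show ?thesis using that by (simp add: z_def algebra_simps)
    qed
    moreover have "z \<in> {1..n} \<rightarrow>\<^sub>E UNIV" by (simp add: z_def)
    ultimately have "z \<in> R" using z_sum unfolding R_def by blast
    then have "?N y \<le> ?N z" using min by (auto simp: sum_nonneg nat_le_eq_zle)
    also have "?N z = (\<Sum>i\<in>{1..n}. y i * y i + ?k * ?k - 2 * ?k * y i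
        + (if i \<in> A then 2 * int n * y i + int n * int n - 2 * ?k * int n else 0))"
      by (intro sum.cong refl) (simp add: z_def algebra_simps)
    also have "\<dots> = ?N y + int n * (?k * ?k) - 2 * ?k * sum y {1..n}
        + (2 * int n * sum y A + ?k * (int n * int n - 2 * ?k * int n))"
      unfolding sum.distrib sum_subtractf sum_e
      by (simp add: sum_distrib_left[symmetric] sum.distrib sum_subtractf right_diff_distrib)
    finally have "0 \<le> int n * (?k * ?k) - ?k * (2 * sum y {1..n})
        + (2 * int n * sum y A + ?k * (int n * int n - 2 * ?k * int n))" by simp
    then have "0 \<le> int n * (2 * sum y A - ?k * (?k - 3)) - 2 * ?k"
      unfolding tot by (simp add: algebra_simps)
    then have "0 < int n * (2 * sum y A - ?k * (?k - 3))" using k by linarith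
    then have "?k * (?k - 3) < 2 * sum y A" using n by (simp add: zero_less_mult_iff)
    \<comment> \<open>Both sides are even, so the strict inequality has a gap of at least 2, and
      \<open>?k * (?k - 3) + 2 = (?k - 1) * (?k - 2)\<close>.\<close>
    moreover have "even (?k * (?k - 3))" by auto
    then obtain q where q: "?k * (?k - 3) = 2 * q" by (rule evenE)
    ultimately have "2 * q < 2 * sum y A" by (simp only:)
    then have "2 * q + 2 \<le> 2 * sum y A" by simp
    then have "?k * (?k - 3) + 2 \<le> 2 * sum y A" by (simp only: q)
    then show ?thesis by (simp add: algebra_simps)
  qed
  then have "y \<in> break_divisors n" using y tot by (simp add: break_divisors_def R_def)
  moreover obtain a where "\<forall>i\<in>{1..n}. [y i = u i + a] (mod int n)"
    using y unfolding R_def by blast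
  ultimately show ?thesis using that by blast
qed

section \<open>The bijection from lattice points to shift classes\<close>

lemma break_divisors_sum:
  assumes "2 \<le> n" "x \<in> break_divisors n"
  shows "sum x {1..n} = int (c_num n)"
  using assms int_c_num[OF assms(1)] by (simp add: break_divisors_def)

lemma bij_betw_shift_class:
  assumes n: "2 \<le> n"
  shows "bij_betw (shift_class n) (lattice_points n) (C_hat n)"
  unfolding lattice_points_eq_break_divisors[OF n]
proof (rule bij_betw_imageI)
  have sum: "[sum x {1..n} = int (c_num n)] (mod int n)" if "x \<in> break_divisors n" for x
    using break_divisors_sum[OF n that] by simp
  show "inj_on (shift_class n) (break_divisors n)"
    using shift_class_eq_iff[OF n sum sum] break_divisors_unique[OF n] by (intro inj_onI) blast
  show "shift_class n ` break_divisors n = C_hat n"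
  proof (intro equalityI subsetI)
    fix c assume "c \<in> C_hat n"
    then obtain u where u: "[sum u {1..n} = int (c_num n)] (mod int n)" "c = shift_class n u"
      using C_hatE[OF n] by blast
    obtain y a where y: "y \<in> break_divisors n" "\<forall>i\<in>{1..n}. [y i = u i + a] (mod int n)"
      using break_divisors_exists[OF n u(1)] .
    then have "c = shift_class n y"
      using shift_class_eq_iff[OF n u(1) sum[OF y(1)]] u(2) by blast
    with y(1) show "c \<in> shift_class n ` break_divisors n" by blast
  qed (use shift_class_in_C_hat[OF n sum] in auto)
qed

lemma finite_C_hat: "finite (C_hat n)"
proof -
  have "finite (C_set n)"
    by (rule finite_subset[of _ "{1..n} \<rightarrow>\<^sub>E {0..n-1}"]) (auto simp: C_set_def intro: finite_PiE)
  then show ?thesis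
    unfolding C_hat_def by (intro finite_quotient) (auto simp: shift_rel_def)
qed

lemma finite_lattice_points: "2 \<le> n \<Longrightarrow> finite (lattice_points n)"
  using bij_betw_finite[OF bij_betw_shift_class] finite_C_hat by blast

subsection \<open>Parking functions\<close>

text \<open>In a sorted list the entries at most \<open>m\<close> form an initial segment.\<close>

lemma sorted_nth_le_iff:
  fixes m :: "'a :: linorder"
  assumes "sorted ys" "i < length ys"
  shows "ys ! i \<le> m \<longleftrightarrow> i < length (filter (\<lambda>y. y \<le> m) ys)"
proof -
  let ?S = "{j. j < length ys \<and> ys ! j \<le> m}"
  have len: "length (filter (\<lambda>y. y \<le> m) ys) = card ?S"
    by (rule length_filter_conv_card)
  show ?thesis
  proof
    assume "ys ! i \<le> m"
    then have "{..i} \<subseteq> ?S"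
      using assms sorted_nth_mono[OF assms(1), of _ i] by (auto intro: order_trans)
    then have "card {..i} \<le> card ?S" by (intro card_mono) auto
    then show "i < length (filter (\<lambda>y. y \<le> m) ys)" by (simp add: len)
  next
    assume *: "i < length (filter (\<lambda>y. y \<le> m) ys)"
    show "ys ! i \<le> m"
    proof (rule ccontr)
      assume "\<not> ys ! i \<le> m"
      have "?S \<subseteq> {..<i}"
      proof (intro subsetI, rule ccontr)
        fix j assume j: "j \<in> ?S" "j \<notin> {..<i}"
        then have "ys ! i \<le> ys ! j" by (intro sorted_nth_mono[OF assms(1)]) auto
        with j \<open>\<not> ys ! i \<le> m\<close> show False by auto
      qed
      then have "card ?S \<le> card {..<i}" by (intro card_mono) auto
      with * show False by (simp add: len)
    qed
  qed
qed

text \<open>The \<open>m\<close>-th smallest entry is at most \<open>m\<close> exactly when at least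
  \<open>m\<close> entries are. This form is visibly invariant under permutation.\<close>

lemma parking_functions_iff:
  "p \<in> parking_functions k \<longleftrightarrow> p \<in> {1..k} \<rightarrow>\<^sub>E {1..} \<and>
    (\<forall>m\<in>{1..k}. m \<le> card {i \<in> {1..k}. p i \<le> m})"
proof -
  let ?l = "map p [1..<Suc k]"
  have *: "length (filter (\<lambda>y. y \<le> m) (sort ?l)) = card {i \<in> {1..k}. p i \<le> m}" for m
  proof -
    have "length (filter (\<lambda>y. y \<le> m) (sort ?l)) = size (filter_mset (\<lambda>y. y \<le> m) (mset ?l))"
      by (metis mset_filter mset_sort size_mset)
    also have "\<dots> = size (filter_mset (\<lambda>i. p i \<le> m) (mset_set {1..k}))"
      unfolding mset_map_upt by (simp add: filter_mset_image_mset)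
    finally show ?thesis by simp
  qed
  have "sort ?l ! (m - 1) \<le> m \<longleftrightarrow> m \<le> card {i \<in> {1..k}. p i \<le> m}" if "m \<in> {1..k}" for m
  proof -
    have "m - 1 < length (sort ?l)" using that by auto
    moreover have "m - 1 < c \<longleftrightarrow> m \<le> c" for c using that by auto
    ultimately show ?thesis
      using sorted_nth_le_iff[of "sort ?l" "m - 1" m] by (simp only: sorted_sort * simp_thms)
  qed
  then show ?thesis by (auto simp: parking_functions_def simp del: upt_Suc)
qed

lemma permute_in_parking_functions:
  assumes \<sigma>: "\<sigma> permutes {1..k}" and p: "p \<in> parking_functions k"
  shows "permute \<sigma> p \<in> parking_functions k"
proof -
  have "card {i \<in> {1..k}. permute \<sigma> p i \<le> m} = card {i \<in> {1..k}. p i \<le> m}" for m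
    using card_permute_fiber[OF \<sigma>, of "\<lambda>i. p i \<le> m"] by (simp add: permute_def)
  then show ?thesis
    using p permute_PiE[OF \<sigma>, of p "{1..}"] by (simp add: parking_functions_iff)
qed

text \<open>The last coordinate is determined modulo \<open>n\<close> by the prescribed sum.\<close>

definition park_tuple :: "nat \<Rightarrow> (nat \<Rightarrow> nat) \<Rightarrow> nat \<Rightarrow> int" where
  "park_tuple n p i =
     (if i = n then int (c_num n) - (\<Sum>j\<in>{1..n-1}. int (p j) - 1) else int (p i) - 1)"

lemma atLeastAtMost_pred:
  fixes n :: nat
  assumes "1 \<le> n"
  shows "{1..n} = insert n {1..n-1}" "n \<notin> {1..n-1}"
  using assms by auto

lemma sum_park_tuple:
  assumes "1 \<le> n"
  shows "sum (park_tuple n p) {1..n} = int (c_num n)"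
proof -
  have "sum (park_tuple n p) {1..n-1} = (\<Sum>j\<in>{1..n-1}. int (p j) - 1)"
    using assms by (intro sum.cong) (auto simp: park_tuple_def)
  then show ?thesis
    unfolding atLeastAtMost_pred(1)[OF assms]
    using atLeastAtMost_pred(2)[OF assms] by (simp add: park_tuple_def)
qed

text \<open>The first \<open>n - 1\<close> differences add up to \<open>(n - 1) * a\<close>,
  congruent to \<open>- a\<close>; as the totals agree modulo \<open>n\<close>, the last difference
  is congruent to \<open>a\<close>.\<close>

lemma cong_last:
  assumes n: "1 \<le> n" and xy: "\<forall>i\<in>{1..n-1}. [y i = x i + a] (mod int n)"
    and "[sum x {1..n} = sum y {1..n}] (mod int n)"
  shows "\<forall>i\<in>{1..n}. [y i = x i + a] (mod int n)"
proof -
  have "[sum y {1..n-1} = (\<Sum>i\<in>{1..n-1}. x i + a)] (mod int n)"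
    using xy by (intro cong_sum) auto
  then have "[sum y {1..n-1} = sum x {1..n-1} + (int n - 1) * a] (mod int n)"
    using n by (simp add: sum.distrib of_nat_diff)
  then have 1: "int n dvd sum y {1..n-1} - (sum x {1..n-1} + (int n - 1) * a)"
    by (simp add: cong_iff_dvd_diff)
  have 2: "int n dvd (x n + sum x {1..n-1}) - (y n + sum y {1..n-1})"
    using assms(3) atLeastAtMost_pred[OF n] by (simp add: cong_iff_dvd_diff)
  have "int n dvd (- (sum y {1..n-1} - (sum x {1..n-1} + (int n - 1) * a))
      - ((x n + sum x {1..n-1}) - (y n + sum y {1..n-1})) - int n * a)"
    by (rule dvd_diff[OF dvd_diff[OF iffD2[OF dvd_minus_iff 1] 2] dvd_triv_left])
  also have "- (sum y {1..n-1} - (sum x {1..n-1} + (int n - 1) * a))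
      - ((x n + sum x {1..n-1}) - (y n + sum y {1..n-1})) - int n * a = y n - (x n + a)"
    by (simp add: algebra_simps)
  finally have "[y n = x n + a] (mod int n)" by (simp add: cong_iff_dvd_diff)
  then show ?thesis unfolding atLeastAtMost_pred(1)[OF n] using xy by blast
qed

text \<open>Pollak's circular argument: if \<open>q\<close> is a shift of \<open>p\<close> by \<open>0 < j < n\<close>, then the at least \<open>j\<close>
  entries of \<open>q\<close> that wrapped around and the at least \<open>n - j\<close> entries of \<open>p\<close> that do not wrap
  around are too many.\<close>

lemma parking_functions_unique:
  assumes n: "2 \<le> n" and p: "p \<in> parking_functions (n - 1)" and q: "q \<in> parking_functions (n - 1)"
    and pq: "\<forall>i\<in>{1..n-1}. [int (q i) = int (p i) + a] (mod int n)"
  shows "p = q"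
proof -
  have range: "1 \<le> x i" "x i \<le> n - 1" if "x \<in> parking_functions (n - 1)" "i \<in> {1..n-1}" for x i
  proof -
    show "1 \<le> x i" using that by (auto simp: parking_functions_iff PiE_iff)
    have "n - 1 \<le> card {i \<in> {1..n-1}. x i \<le> n - 1}"
      using that(1) n by (simp add: parking_functions_iff)
    then have "{i \<in> {1..n-1}. x i \<le> n - 1} = {1..n-1}"
      by (intro card_seteq) auto
    then show "x i \<le> n - 1" using that(2) by blast
  qed
  define j where "j = nat (a mod int n)"
  have j: "int j = a mod int n" "j < n"
    using n pos_mod_bound[of "int n" a] by (simp_all add: j_def nat_less_iff)
  have q_eq: "q i = (p i + j) mod n" if "i \<in> {1..n-1}" for i
  proof -
    have "int (q i) = int (q i) mod int n"
      using range[OF q that] n by simp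
    also have "\<dots> = (int (p i) + int j) mod int n"
      using pq that by (simp add: cong_def j(1) mod_add_right_eq)
    finally show ?thesis by (metis of_nat_add of_nat_eq_iff of_nat_mod)
  qed
  have "j = 0"
  proof (rule ccontr)
    assume "j \<noteq> 0"
    let ?Q = "{i \<in> {1..n-1}. q i \<le> j}" and ?P = "{i \<in> {1..n-1}. p i \<le> n - j}"
    have "i \<notin> ?P" if "i \<in> ?Q" for i
    proof
      assume "i \<in> ?P"
      then have i: "i \<in> {1..n-1}" "p i + j \<le> n" using j(2) by auto
      have "1 \<le> q i" "1 \<le> p i" using range[OF q i(1)] range[OF p i(1)] by auto
      \<comment> \<open>Otherwise \<open>q i\<close> would be the residue 0, but parking functions
        have positive entries.\<close>
      moreover have "p i + j \<noteq> n" using \<open>1 \<le> q i\<close> q_eq[OF i(1)] by auto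
      ultimately have "q i = p i + j" using q_eq[OF i(1)] i(2) by simp
      then show False using that \<open>1 \<le> p i\<close> by simp
    qed
    then have "card ?P + card ?Q = card (?P \<union> ?Q)"
      by (intro card_Un_disjoint[symmetric]) auto
    also have "\<dots> \<le> card {1..n-1}" by (rule card_mono) auto
    finally have "card ?P + card ?Q \<le> n - 1" by simp
    moreover have "j \<le> card ?Q" "n - j \<le> card ?P"
    proof -
      have "j \<in> {1..n-1}" "n - j \<in> {1..n-1}" using \<open>j \<noteq> 0\<close> j(2) by auto
      then show "j \<le> card ?Q" "n - j \<le> card ?P"
        using p q unfolding parking_functions_iff by blast+
    qed
    ultimately show False using j(2) by linarith
  qed
  then have "p i = q i" if "i \<in> {1..n-1}" for i
    using q_eq[OF that] range[OF p that] n by simp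
  then show ?thesis
    using p q by (intro PiE_ext[of p "{1..n-1}" "\<lambda>_. {1..}" q]) (auto simp: parking_functions_iff)
qed

text \<open>A shift with least sum of residues is a parking function: shifting down by \<open>m\<close> lowers
  every entry by \<open>m\<close> except for those below \<open>m\<close>, which increase by \<open>n - m\<close>.\<close>

lemma parking_functions_exists:
  assumes n: "2 \<le> n"
  obtains p a where "p \<in> parking_functions (n - 1)"
    "\<forall>i\<in>{1..n-1}. [int (p i) - 1 = u i + a] (mod int n)"
proof -
  let ?s = "\<lambda>a. \<Sum>i\<in>{1..n-1}. (u i + a) mod int n"
  from ex_has_least_nat[of "\<lambda>_. True" "0 :: int" "\<lambda>a. nat (?s a)"]
  obtain a where a: "\<forall>b. nat (?s a) \<le> nat (?s b)" by auto
  have nonneg: "0 \<le> ?s b" for b using n by (intro sum_nonneg) simp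
  have min: "?s a \<le> ?s b" for b using a nonneg by (simp add: nat_le_eq_zle)
  \<comment> \<open>The offset 1 turns residues from 0 to \<open>n - 1\<close> into entries from 1
    to \<open>n\<close>.\<close>
  define p where "p = (\<lambda>i\<in>{1..n-1}. nat ((u i + a) mod int n) + 1)"
  have p: "int (p i) - 1 = (u i + a) mod int n" if "i \<in> {1..n-1}" for i
    using that n by (simp add: p_def)
  have "m \<le> card {i \<in> {1..n-1}. p i \<le> m}" if m: "m \<in> {1..n-1}" for m
  proof -
    let ?M = "{i \<in> {1..n-1}. p i \<le> m}"
    have "(u i + (a - int m)) mod int n = (u i + a) mod int n - int m + (if i \<in> ?M then int n else 0)"
      if i: "i \<in> {1..n-1}" for i
    proof -
      let ?r = "(u i + a) mod int n"
      have r: "0 \<le> ?r" "?r < int n" using n by simp_all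
      have "(u i + (a - int m)) mod int n = (?r - int m) mod int n"
        by (simp add: mod_diff_left_eq add_diff_eq)
      also have "\<dots> = ?r - int m + (if ?r < int m then int n else 0)"
      proof (cases "?r < int m")
        case True
        have "(?r - int m) mod int n = (?r - int m + int n) mod int n" by simp
        also have "\<dots> = ?r - int m + int n"
          using True r m by (intro mod_pos_pos_trivial) auto
        finally show ?thesis using True by simp
      qed (use r in simp)
      also have "?r < int m \<longleftrightarrow> i \<in> ?M" using p[OF i] i by auto
      finally show ?thesis .
    qed
    then have "?s (a - int m) = (\<Sum>i\<in>{1..n-1}. (u i + a) mod int n - int m + (if i \<in> ?M then int n else 0))"
      by (intro sum.cong) auto
    also have "\<dots> = ?s a - int (n - 1) * int m + (\<Sum>i\<in>{1..n-1}. if i \<in> ?M then int n else 0)"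
      by (simp add: sum.distrib sum_subtractf)
    also have "(\<Sum>i\<in>{1..n-1}. if i \<in> ?M then int n else 0) = (\<Sum>i\<in>?M. int n)"
      by (rule sum.mono_neutral_cong_right) auto
    also have "\<dots> = int n * int (card ?M)" by simp
    \<comment> \<open>As \<open>m < n\<close>, this gives
      \<open>m - card ?M \<le> m / n < 1\<close>, and integrality finishes.\<close>
    finally have "(int n - 1) * int m \<le> int n * int (card ?M)"
      using min[of "a - int m"] n by (simp add: of_nat_diff)
    then have "int n * (int m - int (card ?M)) \<le> int m" by (simp add: algebra_simps)
    moreover have "int m < int n" using m by auto
    ultimately have "int n * (int m - int (card ?M)) < int n * 1" by linarith
    then have "int m - int (card ?M) < 1" using n by (subst (asm) mult_less_cancel_left_pos) auto
    then show ?thesis by linarith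
  qed
  then have "p \<in> parking_functions (n - 1)"
    by (simp add: parking_functions_iff) (simp add: p_def)
  moreover have "[int (p i) - 1 = u i + a] (mod int n)" if "i \<in> {1..n-1}" for i
    unfolding p[OF that] by (simp add: cong_def)
  ultimately show ?thesis using that by blast
qed

text \<open>Given the total modulo \<open>n\<close>, the first \<open>n - 1\<close> coordinates up
  to a common shift determine the class, and exactly one such shift of them is a parking function
  (less 1 in each entry).\<close>

lemma bij_betw_shift_class_park:
  assumes n: "2 \<le> n"
  shows "bij_betw (\<lambda>p. shift_class n (park_tuple n p)) (parking_functions (n - 1)) (C_hat n)"
proof (rule bij_betw_imageI)
  have n1: "1 \<le> n" using n by simp
  have sum: "[sum (park_tuple n p) {1..n} = int (c_num n)] (mod int n)" for p
    using sum_park_tuple[OF n1] by simp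
  have park: "park_tuple n p i = int (p i) - 1" if "i \<in> {1..n-1}" for p i
    using that n by (auto simp: park_tuple_def)
  show "inj_on (\<lambda>p. shift_class n (park_tuple n p)) (parking_functions (n - 1))"
  proof (rule inj_onI)
    fix p q assume pq: "p \<in> parking_functions (n - 1)" "q \<in> parking_functions (n - 1)"
      and "shift_class n (park_tuple n p) = shift_class n (park_tuple n q)"
    then obtain a where a: "\<forall>i\<in>{1..n}. [park_tuple n q i = park_tuple n p i + a] (mod int n)"
      using shift_class_eq_iff[OF n sum sum] by blast
    have "[int (q i) = int (p i) + a] (mod int n)" if "i \<in> {1..n-1}" for i
    proof -
      have "[int (q i) - 1 = int (p i) - 1 + a] (mod int n)"
      proof -
        have "i \<in> {1..n}" using that by auto
        then show ?thesis using bspec[OF a] by (simp only: park[OF that, symmetric])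
      qed
      then show ?thesis by (simp add: cong_iff_dvd_diff algebra_simps)
    qed
    then show "p = q" using parking_functions_unique[OF n pq] by blast
  qed
  show "(\<lambda>p. shift_class n (park_tuple n p)) ` parking_functions (n - 1) = C_hat n"
  proof (intro equalityI subsetI)
    fix c assume "c \<in> C_hat n"
    then obtain u where u: "[sum u {1..n} = int (c_num n)] (mod int n)" "c = shift_class n u"
      using C_hatE[OF n] by blast
    obtain p a where p: "p \<in> parking_functions (n - 1)"
        "\<forall>i\<in>{1..n-1}. [int (p i) - 1 = u i + a] (mod int n)"
      using parking_functions_exists[OF n] .
    have "\<forall>i\<in>{1..n}. [park_tuple n p i = u i + a] (mod int n)"
    proof (rule cong_last[OF n1])
      show "\<forall>i\<in>{1..n-1}. [park_tuple n p i = u i + a] (mod int n)"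
      proof
        fix i assume i: "i \<in> {1..n-1}"
        show "[park_tuple n p i = u i + a] (mod int n)"
          unfolding park[OF i] by (rule bspec[OF p(2) i])
      qed
      show "[sum u {1..n} = sum (park_tuple n p) {1..n}] (mod int n)"
        using u(1) sum_park_tuple[OF n1] by simp
    qed
    then have "c = shift_class n (park_tuple n p)"
      using shift_class_eq_iff[OF n u(1) sum] u(2) by blast
    with p(1) show "c \<in> (\<lambda>p. shift_class n (park_tuple n p)) ` parking_functions (n - 1)" by blast
  qed (use shift_class_in_C_hat[OF n sum] in auto)
qed

text \<open>Here \<open>\<sigma>\<close> fixes \<open>n\<close>, and the completed last entry
  depends only on a sum that \<open>\<sigma>\<close> preserves.\<close>

lemma shift_class_permute_park:
  assumes n: "2 \<le> n" and \<sigma>: "\<sigma> permutes {1..n-1}"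
  shows "shift_class n (park_tuple n (permute \<sigma> p)) = permute \<sigma> ` shift_class n (park_tuple n p)"
proof -
  have \<sigma>n: "\<sigma> permutes {1..n}" using \<sigma> by (rule permutes_subset) auto
  have \<sigma>': "inv' \<sigma> permutes {1..n-1}" using \<sigma> by (rule permutes_inv)
  have "n \<notin> {1..n-1}" using n by simp
  then have fix_n: "inv' \<sigma> n = n" by (rule permutes_not_in[OF \<sigma>'])
  have "(\<Sum>j\<in>{1..n-1}. int (permute \<sigma> p j) - 1) = (\<Sum>j\<in>{1..n-1}. int (p j) - 1)"
    using sum_permute_carrier[OF \<sigma>, of "\<lambda>j. int (p j) - 1"] by (simp add: permute_def)
  moreover have "inv' \<sigma> i = n \<longleftrightarrow> i = n" for i
    using fix_n permutes_inj[OF \<sigma>'] by (metis injD)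
  ultimately have "park_tuple n (permute \<sigma> p) i = permute \<sigma> (park_tuple n p) i" for i
    by (simp add: park_tuple_def permute_def)
  then have "park_tuple n (permute \<sigma> p) = permute \<sigma> (park_tuple n p)" ..
  then show ?thesis using permute_shift_class[OF n \<sigma>n, of "park_tuple n p"] by simp
qed

text \<open>The equivariant bijection is \<open>f\<close> followed by the inverse of
  \<open>h\<close>. It compares lattice points with parking functions through
  \<open>C_hat\<close>.\<close>

lemma rep_iso_perm_rep_via:
  assumes act: "action_on G X a" "action_on G Y b"
    and f: "bij_betw f X Z" "\<And>g x. g \<in> carrier G \<Longrightarrow> x \<in> X \<Longrightarrow> f (a g x) = c g (f x)"
    and h: "bij_betw h Y Z" "\<And>g y. g \<in> carrier G \<Longrightarrow> y \<in> Y \<Longrightarrow> h (b g y) = c g (h y)"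
  shows "rep_iso G (perm_rep X a) (perm_rep Y b)"
proof (rule rep_iso_perm_rep[OF act])
  let ?i = "the_inv_into Y h"
  show "bij_betw (?i \<circ> f) X Y"
    using f(1) bij_betw_the_inv_into[OF h(1)] by (rule bij_betw_trans)
  show "(?i \<circ> f) (a g x) = b g ((?i \<circ> f) x)" if g: "g \<in> carrier G" and x: "x \<in> X" for g x
  proof -
    have inj: "inj_on h Y" and im: "h ` Y = Z" using h(1) by (auto simp: bij_betw_def)
    have "f x \<in> h ` Y" using f(1) x im by (auto simp: bij_betw_def)
    then obtain y where y: "y \<in> Y" "f x = h y" by auto
    then have "f (a g x) = h (b g y)" using f(2)[OF g x] h(2)[OF g y(1)] by simp
    moreover have "b g y \<in> Y" using act(2) g y(1) by (simp add: action_on_def)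
    ultimately show ?thesis using y the_inv_into_f_f[OF inj] by simp
  qed
qed

theorem theorem4p3:
  fixes n :: nat
  assumes "n \<ge> 2"
  shows "rep_iso (sym_group n) (gamma_rep n) (tau_hat_rep n) \<and>
    rep_iso (sym_group (n - 1)) (gamma_rep n) (Park (n - 1)) \<and>
    Frob n (gamma_rep n) = Frob n (tau_hat_rep n) \<and>
    Frob n (tau_hat_rep n) = (\<Sum>x\<in>Par_le_delta n. h_part (mult_part n x))"
proof -
  have lattice: "permute \<sigma> x \<in> lattice_points n" if "\<sigma> permutes {1..n}" "x \<in> lattice_points n" for \<sigma> x
    using permute_in_break_divisors that unfolding lattice_points_eq_break_divisors[OF assms] .
  \<comment> \<open>The smaller symmetric group sits in the larger one as the permutations fixing
    \<open>n\<close>; this realises the restriction.\<close>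
  have sub: "\<sigma> permutes {1..n}" if "\<sigma> permutes {1..n-1}" for \<sigma>
    using that by (rule permutes_subset) auto
  have equiv: "shift_class n (permute \<sigma> x) = permute \<sigma> ` shift_class n x"
    if "\<sigma> \<in> carrier (sym_group n)" for \<sigma> x
    using permute_shift_class[OF assms] that by (simp add: sym_group_carrier)
  have gamma_tau: "rep_iso (sym_group n) (gamma_rep n) (tau_hat_rep n)"
    unfolding gamma_rep_def tau_hat_rep_def
    by (rule rep_iso_perm_rep[OF _ action_on_C_hat[OF assms] bij_betw_shift_class[OF assms]])
      (rule action_on_permute, rule lattice, assumption+, rule equiv)
  have gamma_park: "rep_iso (sym_group (n - 1)) (gamma_rep n) (Park (n - 1))"
    unfolding gamma_rep_def Park_def
  proof (rule rep_iso_perm_rep_via[OF _ _ bij_betw_shift_class[OF assms] _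
        bij_betw_shift_class_park[OF assms]])
    show "action_on (sym_group (n - 1)) (lattice_points n) permute"
      by (rule action_on_permute) (rule lattice[OF sub])
    show "action_on (sym_group (n - 1)) (parking_functions (n - 1)) permute"
      by (rule action_on_permute) (rule permute_in_parking_functions)
    show "shift_class n (permute \<sigma> x) = permute \<sigma> ` shift_class n x"
      if "\<sigma> \<in> carrier (sym_group (n - 1))" for \<sigma> x
      using that equiv sub by (simp add: sym_group_carrier)
    show "shift_class n (park_tuple n (permute \<sigma> p)) = permute \<sigma> ` shift_class n (park_tuple n p)"
      if "\<sigma> \<in> carrier (sym_group (n - 1))" for \<sigma> p
      using that shift_class_permute_park[OF assms] by (simp add: sym_group_carrier)
  qed
  have frob_eq: "Frob n (gamma_rep n) = Frob n (tau_hat_rep n)"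
    unfolding gamma_rep_def tau_hat_rep_def
    by (rule Frob_perm_rep_bij[OF finite_lattice_points[OF assms] bij_betw_shift_class[OF assms]])
      (use lattice equiv in \<open>simp_all add: sym_group_carrier\<close>)
  have "Frob n (gamma_rep n) = (\<Sum>x\<in>Par_le_delta n. h_part (mult_part n x))"
    unfolding gamma_rep_def Par_le_delta_def
  proof (rule Frob_permute[OF finite_lattice_points[OF assms]])
    show "lattice_points n \<subseteq> {1..n} \<rightarrow>\<^sub>E UNIV" by (auto simp: lattice_points_def)
  qed (rule lattice)
  with gamma_tau gamma_park frob_eq show ?thesis by simp
qed

end
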